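(* Let $X$ be an Asplund space, let $(T,\preccurlyeq)$ be a tree with finitely many initial nodes, and let $i\colon X\to C([T])$ be an isometric (linear) embedding, where $[T]$ carries the tree topology. Then for every $\varepsilon>0$ there exist a well-founded, compact tree $S$ with ordinal index $\mathrm{o}(S)<\mathrm{Sz}(X,\varepsilon/2)+\omega$ and a subspace $Y$ of $C([T])$ isometrically isomorphic to $C(S)$ (with $S=[S]$ carrying its tree topology) such that for all $x\in X$ there exists $y\in Y$ with $\|i(x)-y\|\le\varepsilon\|x\|$.
   Context: Trees. A tree is a set $T$ with a reflexive partial order $\preccurlyeq$ such that for each $t\in T$ the set $b_t=\{s\in T: s\preccurlyeq t\}$ is finite and linearly ordered. Initial nodes are the minimal elements of $T$. For non-minimal $t$, the direct predecessor of $t$ is the maximum of $b_t\setminus\{t\}$. A branch of $T$ is a non-empty linearly ordered subset of $T$ closed under taking direct predecessors. $[T]$ is the set of all branches. Each finite branch equals $b_t$ for a unique $t\in T$ and is identified with $t$, so that $[T]=T\cup\partial T$, where $\partial T$ is the set of infinite branches. $T$ is well-founded if $\partial T=\emptyset$ (then $[T]=T$). For $t\in T$ put $U_t=\{b\in[T]: t\in b\}$; the tree topology on $[T]$ is the topology generated by $\{U_t,\ [T]\setminus U_t: t\in T\}$. A tree is called compact if $[T]$ is compact in the tree topology, which holds if and only if $T$ has finitely many initial nodes. Ordinal index. For a well-founded tree $T$ and $S\subset T$ let $S'$ be the set of elements of $S$ that are not maximal in $S$. Put $T^{(0)}=T$, $T^{(\gamma+1)}=(T^{(\gamma)})'$,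 $T^{(\alpha)}=\bigcap_{\gamma<\alpha}T^{(\gamma)}$ for limit ordinals $\alpha$. Then $\mathrm{o}(T)=\min\{\alpha: T^{(\alpha)}=\emptyset\}$. Asplund spaces and the Szlenk index. A Banach space $X$ is an Asplund space if every separable subspace of $X$ has separable dual. For a $w^*$-closed $F\subset B_{X^*}$ and $\varepsilon>0$ let $F'_\varepsilon$ be the set of those $\xi\in F$ such that $\mathrm{diam}_{\|\cdot\|}(U\cap F)\ge\varepsilon$ for every $w^*$-open neighbourhood $U$ of $\xi$. Put $F^{(0)}_\varepsilon=F$, $F^{(\gamma+1)}_\varepsilon=(F^{(\gamma)}_\varepsilon)'_\varepsilon$, $F^{(\alpha)}_\varepsilon=\bigcap_{\gamma<\alpha}F^{(\gamma)}_\varepsilon$ for limit $\alpha$. The $\varepsilon$-Szlenk index $\mathrm{Sz}(X,\varepsilon)$ is the least ordinal $\beta$ with $(B_{X^*})^{(\beta)}_\varepsilon=\emptyset$; for Asplund $X$ it exists for every $\varepsilon>0$. $C(K)$ is the Banach space of continuous real-valued functions on a compact Hausdorff space $K$ with the supremum norm; Banach spaces are real. Sums of ordinals are ordinal sums. *)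

theory Defs
  imports "HOL-Analysis.Analysis"
begin

section \<open>Ordinals\<close>

text \<open>An ordinal is represented by a well-order relation, as in the BNF well-order theories of
  Main: the ordinals below \<^term>\<open>r\<close> are the initial segments \<^term>\<open>Restr r (underS r a)\<close> with
  \<^term>\<open>a \<in> Field r\<close>, and \<open><o\<close>, \<open>\<le>o\<close> compare ordinals, also across types.
  The ordinal \<open>\<omega>\<close> is \<^term>\<open>natLeq\<close>.\<close>

notation ordLeq3 (infix \<open>\<le>o\<close> 50) and ordLess2 (infix \<open><o\<close> 50)

text \<open>Ordinal sum: a copy of \<^term>\<open>r\<close> followed by a copy of \<^term>\<open>q\<close>.\<close>

definition ord_sum :: "'a rel \<Rightarrow> 'b rel \<Rightarrow> ('a + 'b) rel" (infixr \<open>+o\<close> 70) where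
  "r +o q = map_prod Inl Inl ` r \<union> map_prod Inr Inr ` q
     \<union> {(Inl a, Inr b) | a b. a \<in> Field r \<and> b \<in> Field q}"

definition greatest_elt :: "'c rel \<Rightarrow> 'c \<Rightarrow> bool" where
  "greatest_elt r m \<longleftrightarrow> m \<in> Field r \<and> (\<forall>a\<in>Field r. (a, m) \<in> r)"

text \<open>The iterate \<open>F\<^sup>(\<^sup>\<alpha>\<^sup>)\<close> of a derivation \<open>D\<close>, with \<open>\<alpha>\<close> the ordinal of the well-order \<open>r\<close>. The three
  cases are \<open>\<alpha> = 0\<close>, \<open>\<alpha> = \<gamma> + 1\<close> (i.e. \<open>r\<close> has a greatest element \<open>m\<close>, and \<open>\<gamma>\<close> is the ordinal of
  the elements below \<open>m\<close>), and \<open>\<alpha>\<close> a limit. For a relation that is not a well-order the value is a dummy.\<close>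

function iterated_deriv :: "('s set \<Rightarrow> 's set) \<Rightarrow> 's set \<Rightarrow> 'c rel \<Rightarrow> 's set" where
  "iterated_deriv D F r =
    (if \<not> Well_order r \<or> r = {} then F
     else if \<exists>m. greatest_elt r m
       then D (iterated_deriv D F (Restr r (underS r (THE m. greatest_elt r m))))
     else (\<Inter>a\<in>Field r. iterated_deriv D F (Restr r (underS r a))))"
  by pat_completeness auto
termination
proof (relation "inv_image ordLess (\<lambda>(D, F, r). r)")
  show "wf (inv_image ordLess (\<lambda>(D :: 's set \<Rightarrow> 's set, F :: 's set, r :: 'c rel). r))"
    by (rule wf_inv_image[OF wf_ordLess])
qed (auto intro!: underS_Restr_ordLess dest: FieldI1)

declare iterated_deriv.simps [simp del]

text \<open>The least ordinal \<open>\<alpha>\<close> with \<open>F\<^sup>(\<^sup>\<alpha>\<^sup>) = \<emptyset>\<close>, determined up to order isomorphism and unspecified if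
  there is none. Looking for it among well-orders on subsets of the type \<^typ>\<open>'s\<close> of the
  elements of \<open>F\<close> loses nothing: for a derivation with \<open>D A \<subseteq> A\<close> each step below that ordinal removes
  an element of \<open>F\<close>, so the ordinal is the order type of a well-order on a subset of \<open>F\<close>.\<close>

definition deriv_index :: "('s set \<Rightarrow> 's set) \<Rightarrow> 's set \<Rightarrow> 's rel" where
  "deriv_index D F = (SOME r. Well_order r \<and> iterated_deriv D F r = {} \<and>
     (\<forall>r' :: 's rel. Well_order r' \<and> iterated_deriv D F r' = {} \<longrightarrow> r \<le>o r'))"


section \<open>Trees\<close>

text \<open>For \<^term>\<open>t \<in> T\<close> the set \<open>b\<^sub>t\<close> is \<^term>\<open>under r t\<close>.\<close>

definition tree :: "'t set \<Rightarrow> 't rel \<Rightarrow> bool" where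
  "tree T r \<longleftrightarrow> partial_order_on T r \<and>
     (\<forall>t\<in>T. finite (under r t) \<and> total_on (under r t) r)"

definition initial_nodes :: "'t set \<Rightarrow> 't rel \<Rightarrow> 't set" where
  "initial_nodes T r = {t\<in>T. \<forall>s\<in>T. (s, t) \<in> r \<longrightarrow> s = t}"

definition direct_pred :: "'t rel \<Rightarrow> 't \<Rightarrow> 't \<Rightarrow> bool" where
  "direct_pred r s t \<longleftrightarrow> s \<in> underS r t \<and> (\<forall>u\<in>underS r t. (u, s) \<in> r)"

definition branches :: "'t set \<Rightarrow> 't rel \<Rightarrow> 't set set" where
  "branches T r = {b. b \<noteq> {} \<and> b \<subseteq> T \<and> total_on b r \<and>
     (\<forall>t\<in>b. \<forall>s. direct_pred r s t \<longrightarrow> s \<in> b)}"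

definition well_founded_tree :: "'t set \<Rightarrow> 't rel \<Rightarrow> bool" where
  "well_founded_tree T r \<longleftrightarrow> tree T r \<and> (\<forall>b\<in>branches T r. finite b)"

definition tree_nbhd :: "'t set \<Rightarrow> 't rel \<Rightarrow> 't \<Rightarrow> 't set set" where
  "tree_nbhd T r t = {b\<in>branches T r. t \<in> b}"

text \<open>The space \<open>[T]\<close>; the generating sets cover it, so its \<^const>\<open>topspace\<close> is
  \<^term>\<open>branches T r\<close>. For a well-founded tree this is also the space \<open>T\<close>, a node \<open>t\<close> being
  identified with the branch \<open>b\<^sub>t\<close>.\<close>

definition tree_topology :: "'t set \<Rightarrow> 't rel \<Rightarrow> 't set topology" where
  "tree_topology T r = topology_generated_by
     (tree_nbhd T r ` T \<union> (\<lambda>t. branches T r - tree_nbhd T r t) ` T)"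

lemma topspace_tree_topology: "topspace (tree_topology T r) = branches T r"
  unfolding tree_topology_def topology_generated_by_topspace
  by (auto simp: tree_nbhd_def branches_def)

definition compact_tree :: "'t set \<Rightarrow> 't rel \<Rightarrow> bool" where
  "compact_tree T r \<longleftrightarrow> tree T r \<and> compact_space (tree_topology T r)"

definition tree_deriv :: "'t rel \<Rightarrow> 't set \<Rightarrow> 't set" where
  "tree_deriv r A = {s\<in>A. \<exists>t\<in>A. (s, t) \<in> r \<and> s \<noteq> t}"

definition tree_index :: "'t set \<Rightarrow> 't rel \<Rightarrow> 't rel" where
  "tree_index T r = deriv_index (tree_deriv r) T"


section \<open>Asplund spaces and the Szlenk index\<close>

text \<open>The dual of a linear subspace \<open>M\<close>, which is not a type; functionals are extended by
  \<^const>\<open>undefined\<close> outside \<open>M\<close>.\<close>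

definition subspace_dual :: "'a::real_normed_vector set \<Rightarrow> ('a \<Rightarrow> real) set" where
  "subspace_dual M = {f \<in> extensional M.
     (\<forall>x\<in>M. \<forall>y\<in>M. f (x + y) = f x + f y) \<and>
     (\<forall>c. \<forall>x\<in>M. f (c *\<^sub>R x) = c * f x) \<and>
     (\<exists>B. \<forall>x\<in>M. \<bar>f x\<bar> \<le> B * norm x)}"

definition subspace_dual_dist ::
    "'a::real_normed_vector set \<Rightarrow> ('a \<Rightarrow> real) \<Rightarrow> ('a \<Rightarrow> real) \<Rightarrow> real" where
  "subspace_dual_dist M f g = (SUP x\<in>{x\<in>M. norm x \<le> 1}. \<bar>f x - g x\<bar>)"

definition separable_dual :: "'a::real_normed_vector set \<Rightarrow> bool" where
  "separable_dual M \<longleftrightarrow> (\<exists>D. countable D \<and> D \<subseteq> subspace_dual M \<and>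
     (\<forall>f\<in>subspace_dual M. \<forall>e>0. \<exists>g\<in>D. subspace_dual_dist M f g < e))"

definition asplund :: "'a::banach itself \<Rightarrow> bool" where
  "asplund _ \<longleftrightarrow> (\<forall>M :: 'a set. subspace M \<and> separable_space (top_of_set M) \<longrightarrow> separable_dual M)"

text \<open>For functionals, \<^const>\<open>strong_operator_topology\<close> is the topology of pointwise convergence,
  i.e. the \<open>w\<^sup>*\<close>-topology.\<close>

definition szlenk_deriv ::
    "real \<Rightarrow> ('a::real_normed_vector \<Rightarrow>\<^sub>L real) set \<Rightarrow> ('a \<Rightarrow>\<^sub>L real) set" where
  "szlenk_deriv e F = {\<xi>\<in>F. \<forall>U. openin strong_operator_topology U \<and> \<xi> \<in> U
     \<longrightarrow> diameter (U \<inter> F) \<ge> e}"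

definition szlenk_index :: "'a::banach itself \<Rightarrow> real \<Rightarrow> ('a \<Rightarrow>\<^sub>L real) rel" where
  "szlenk_index _ e = deriv_index (szlenk_deriv e) (cball 0 1)"


section \<open>Spaces of continuous functions\<close>

text \<open>For compact \<open>K\<close>, \<^term>\<open>cfunspace K euclidean_metric\<close> consists of all continuous real functions
  on \<open>K\<close>, extended by \<^const>\<open>undefined\<close> outside \<^term>\<open>topspace K\<close>, with the supremum distance.\<close>

abbreviation C_space :: "'k topology \<Rightarrow> ('k \<Rightarrow> real) metric" where
  "C_space K \<equiv> cfunspace K euclidean_metric"

definition C_zero :: "'k topology \<Rightarrow> 'k \<Rightarrow> real" where
  "C_zero K = (\<lambda>k\<in>topspace K. 0)"

definition C_add :: "'k topology \<Rightarrow> ('k \<Rightarrow> real) \<Rightarrow> ('k \<Rightarrow> real) \<Rightarrow> 'k \<Rightarrow> real" where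
  "C_add K f g = (\<lambda>k\<in>topspace K. f k + g k)"

definition C_scale :: "'k topology \<Rightarrow> real \<Rightarrow> ('k \<Rightarrow> real) \<Rightarrow> 'k \<Rightarrow> real" where
  "C_scale K c f = (\<lambda>k\<in>topspace K. c * f k)"

definition isometric_embedding_C :: "('a::real_normed_vector \<Rightarrow> 'k \<Rightarrow> real) \<Rightarrow> 'k topology \<Rightarrow> bool" where
  "isometric_embedding_C i K \<longleftrightarrow>
     range i \<subseteq> mspace (C_space K) \<and>
     (\<forall>x y. i (x + y) = C_add K (i x) (i y)) \<and>
     (\<forall>c x. i (c *\<^sub>R x) = C_scale K c (i x)) \<and>
     (\<forall>x y. mdist (C_space K) (i x) (i y) = dist x y)"

definition subspace_C :: "('k \<Rightarrow> real) set \<Rightarrow> 'k topology \<Rightarrow> bool" where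
  "subspace_C Y K \<longleftrightarrow> Y \<subseteq> mspace (C_space K) \<and> C_zero K \<in> Y \<and>
     (\<forall>f\<in>Y. \<forall>g\<in>Y. C_add K f g \<in> Y) \<and> (\<forall>c. \<forall>f\<in>Y. C_scale K c f \<in> Y)"

text \<open>The subspace \<open>Y\<close> of \<open>C(K)\<close> is isometrically isomorphic to \<open>C(L)\<close>; for compact \<open>L\<close> such a \<open>Y\<close> is
  complete, hence automatically closed.\<close>

definition isometrically_isomorphic_C ::
    "('k \<Rightarrow> real) set \<Rightarrow> 'k topology \<Rightarrow> 'l topology \<Rightarrow> bool" where
  "isometrically_isomorphic_C Y K L \<longleftrightarrow> (\<exists>\<phi>.
     bij_betw \<phi> Y (mspace (C_space L)) \<and>
     (\<forall>f\<in>Y. \<forall>g\<in>Y. \<phi> (C_add K f g) = C_add L (\<phi> f) (\<phi> g)) \<and>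
     (\<forall>c. \<forall>f\<in>Y. \<phi> (C_scale K c f) = C_scale L c (\<phi> f)) \<and>
     (\<forall>f\<in>Y. \<forall>g\<in>Y. mdist (C_space L) (\<phi> f) (\<phi> g) = mdist (C_space K) f g))"

text \<open>Existential quantification over trees \<open>S\<close> has to fix the type of the nodes of \<open>S\<close>. If \<open>S\<close> is
  well-founded and compact and \<open>C(S)\<close> embeds isometrically into \<open>C([T])\<close> with \<open>T\<close> a compact tree, then
  \<open>S\<close> has at most as many nodes as \<open>T\<close> (compare dimensions if \<open>T\<close> is finite, density characters
  otherwise), so that the node type of \<open>T\<close> is enough.\<close>

end

(*
  Composing with evaluation maps every point b of K = [T] to a functional phi(b) in the dual
  ball, weak*-continuously.  Let rk(b) be the stage at which phi(b) is removed by the Szlenk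
  derivation for epsilon/2.  On a compact open set W the rank attains its maximum on a non-empty
  closed set, the top of W; call W good if phi has oscillation at most epsilon/2 on its top.  Small
  clopen neighbourhoods are good, and since K comes from a tree every open set is a disjoint
  union of good clopen sets.  Starting with such a partition of K, and repeatedly partitioning W
  minus its top, gives a laminar family of clopen sets: a tree S under reverse inclusion.  The
  top rank decreases strictly along S, so S is well-founded with o(S) <= Sz(X, epsilon/2).  Sending b to
  the branch of all members of S that contain b is a continuous surjection rho from K onto [S]
  whose fibres are the tops.  Elements of i(X) oscillate by at most (epsilon/2)||x|| on the fibres of rho,
  so locally constant functions on [S], composed with rho, approximate them.
*)
theory Submission
  imports Defs
begin

section \<open>Transfinite iteration of derivations\<close>

text \<open>The Asplund property enters through one fact: the Szlenk derivation strictly shrinks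
  every non-empty subset of the dual ball, so its iteration reaches the empty set and
  \<open>szlenk_index\<close> is a genuine ordinal. The stages are weak-star closed, so the rank is
  upper semicontinuous, which is why it attains a maximum on compact sets. Goodness is a local
  matter because the top of a set containing b has rank at least that of b, so close to b it is
  mapped into a slice of one single stage, of diameter below epsilon/2. The obstacle is that W minus
  its top is merely open. In a general zero-dimensional compact space an open set need not be a
  disjoint union of clopen sets (the countable ordinals inside the space of ordinals up to omega_1),
  so the tree structure has to supply the partition. Halving epsilon makes the oscillation on fibres
  strictly smaller than the permitted error, and only a strict bound spreads from a fibre to a
  neighbourhood of it. The nodes of S must have the node type of T, so the clopen sets are finally
  counted and relabelled.\<close>

definition seg :: "'c rel \<Rightarrow> 'c \<Rightarrow> 'c rel" where
  "seg r a = Restr r (underS r a)"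

lemma Well_order_seg: "Well_order r \<Longrightarrow> Well_order (seg r a)"
  by (simp add: seg_def Well_order_Restr)

lemma Field_seg: "Well_order r \<Longrightarrow> Field (seg r a) = underS r a"
  unfolding seg_def
  by (rule Field_Restr_ofilter) (auto intro: wo_rel.underS_ofilter simp: wo_rel_def)

lemma seg_ordLess: "Well_order r \<Longrightarrow> a \<in> Field r \<Longrightarrow> seg r a <o r"
  unfolding seg_def by (rule underS_Restr_ordLess) auto

lemma underS_trans: "Well_order r \<Longrightarrow> b \<in> underS r a \<Longrightarrow> c \<in> underS r b \<Longrightarrow> c \<in> underS r a"
  unfolding underS_def wo_rel_def[symmetric]
  using wo_rel.TRANS[of r] wo_rel.ANTISYM[of r] unfolding trans_def antisym_def by blast

lemma underS_subset_Field: "b \<in> underS r a \<Longrightarrow> b \<in> Field r"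
  by (auto simp: underS_def Field_def)

lemma Well_order_cases:
  assumes "Well_order r" "a \<in> Field r" "b \<in> Field r"
  shows "a \<in> underS r b \<or> a = b \<or> b \<in> underS r a"
  using assms wo_rel.TOTAL[of r] unfolding total_on_def underS_def wo_rel_def by auto

lemma not_underS_sym: "Well_order r \<Longrightarrow> a \<in> underS r b \<Longrightarrow> b \<notin> underS r a"
  using wo_rel.ANTISYM[of r] unfolding underS_def wo_rel_def antisym_def by auto

lemma seg_seg:
  assumes "Well_order r" "b \<in> underS r a"
  shows "seg (seg r a) b = seg r b"
proof -
  have *: "underS (seg r a) b = underS r b"
    using assms underS_trans[OF assms] unfolding seg_def by (auto simp: underS_def)
  then show ?thesis
    using underS_trans[OF assms] unfolding seg_def[of "seg r a"] * by (auto simp: seg_def)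
qed

text \<open>A uniform formula for the zero, successor and limit cases.\<close>

lemma iterated_deriv_eq:
  assumes D: "\<And>A. D A \<subseteq> A" and wo: "Well_order r"
  shows "iterated_deriv D F r = F \<inter> (\<Inter>a\<in>Field r. D (iterated_deriv D F (seg r a)))"
  using wo
proof (induction r rule: wf_induct_rule[OF wf_ordLess])
  case hyp: (1 r)
  let ?G = "\<lambda>r. iterated_deriv D F r"
  have IH: "?G (seg r a) = F \<inter> (\<Inter>b\<in>underS r a. D (?G (seg r b)))" if "a \<in> Field r" for a
  proof -
    have "?G (seg r a) = F \<inter> (\<Inter>b\<in>Field (seg r a). D (?G (seg (seg r a) b)))"
      using hyp(1)[OF seg_ordLess[OF hyp(2) that] Well_order_seg[OF hyp(2)]] .
    also have "\<dots> = F \<inter> (\<Inter>b\<in>underS r a. D (?G (seg r b)))"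
      using hyp(2) by (simp add: Field_seg seg_seg)
    finally show ?thesis .
  qed
  consider "r = {}" | m where "r \<noteq> {}" "greatest_elt r m" | "r \<noteq> {}" "\<nexists>m. greatest_elt r m"
    by blast
  then show ?case
  proof cases
    case 1
    then show ?thesis using iterated_deriv.simps[of D F "{}"] by simp
  next
    case (2 m)
    have un: "m' = m" if "greatest_elt r m'" for m'
      using that 2 hyp(2) wo_rel.ANTISYM[of r] by (auto simp: greatest_elt_def wo_rel_def antisym_def)
    then have the: "(THE m. greatest_elt r m) = m" using 2 by blast
    have ex: "\<exists>m. greatest_elt r m" using 2 by blast
    have mF: "m \<in> Field r" using 2 by (simp add: greatest_elt_def)
    have eq: "?G r = D (?G (seg r m))"
      using 2(1) hyp(2) ex the by (subst iterated_deriv.simps) (simp add: seg_def)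
    have Fi: "Field r = insert m (underS r m)"
      using 2 by (auto simp: greatest_elt_def underS_def Field_def)
    show ?thesis unfolding eq Fi using D[of "?G (seg r m)"] IH[OF mF] by auto
  next
    case 3
    have eq: "?G r = (\<Inter>a\<in>Field r. ?G (seg r a))"
      using 3 hyp(2) by (subst iterated_deriv.simps) (auto simp add: seg_def)
    have ne: "Field r \<noteq> {}" using 3 by (auto simp: Field_def)
    \<comment> \<open>With no greatest element, each stage \<open>a\<close> has a strictly later
      one, and the formula for that later stage already contains \<open>D\<close> of stage
      \<open>a\<close>.\<close>
    have up: "\<exists>b\<in>Field r. a \<in> underS r b" if a: "a \<in> Field r" for a
    proof -
      obtain b where "b \<in> Field r" "(b, a) \<notin> r" using 3 a by (auto simp: greatest_elt_def)
      moreover have "(a, a) \<in> r" using a hyp(2) wo_rel.REFL[of r] by (auto simp: wo_rel_def refl_on_def)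
      ultimately show ?thesis using Well_order_cases[OF hyp(2) a, of b] by (auto simp: underS_def)
    qed
    have "(\<Inter>a\<in>Field r. ?G (seg r a)) = (\<Inter>a\<in>Field r. F \<inter> (\<Inter>b\<in>underS r a. D (?G (seg r b))))"
      using IH by auto
    also have "\<dots> = F \<inter> (\<Inter>a\<in>Field r. D (?G (seg r a)))"
      (is "(\<Inter>a\<in>Field r. F \<inter> ?H a) = F \<inter> ?I")
    proof
      obtain a0 where "a0 \<in> Field r" using ne by blast
      then have "(\<Inter>a\<in>Field r. F \<inter> ?H a) \<subseteq> F" by blast
      moreover have "(\<Inter>a\<in>Field r. F \<inter> ?H a) \<subseteq> D (?G (seg r a))" if a: "a \<in> Field r" for a
      proof -
        obtain b where b: "b \<in> Field r" "a \<in> underS r b" using up[OF a] by auto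
        have "(\<Inter>a\<in>Field r. F \<inter> ?H a) \<subseteq> ?H b" using b(1) by auto
        also have "\<dots> \<subseteq> D (?G (seg r a))" using b(2) by auto
        finally show ?thesis .
      qed
      ultimately show "(\<Inter>a\<in>Field r. F \<inter> ?H a) \<subseteq> F \<inter> ?I" by blast
      have "?I \<subseteq> ?H a" for a
        by (rule INF_superset_mono) (use underS_subset_Field in auto)
      then show "F \<inter> ?I \<subseteq> (\<Inter>a\<in>Field r. F \<inter> ?H a)" by auto
    qed
    finally show ?thesis using eq by simp
  qed
qed


lemma iterated_deriv_seg:
  assumes D: "\<And>A. D A \<subseteq> A" and wo: "Well_order r"
  shows "iterated_deriv D F (seg r a) = F \<inter> (\<Inter>b\<in>underS r a. D (iterated_deriv D F (seg r b)))"
  by (subst iterated_deriv_eq[OF D Well_order_seg[OF wo]]) (simp add: Field_seg[OF wo] seg_seg[OF wo])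

text \<open>Initial segments of isomorphic well-orders correspond up to isomorphism, so by induction
  both iterates intersect the same family of sets. This allows an index to be moved from one carrier
  type to another.\<close>

lemma iterated_deriv_ordIso:
  fixes r :: "'c rel" and r' :: "'d rel"
  assumes D: "\<And>A. D A \<subseteq> A"
  shows "(r, r') \<in> ordIso \<Longrightarrow> iterated_deriv D F r = iterated_deriv D F r'"
proof (induction r arbitrary: r' rule: wf_induct_rule[OF wf_ordLess])
  case (1 r)
  have wo: "Well_order r" "Well_order r'" using 1(2) by (auto simp: ordIso_def)
  have a: "\<exists>a'\<in>Field r'. iterated_deriv D F (seg r a) = iterated_deriv D F (seg r' a')"
    if "a \<in> Field r" for a
  proof -
    have "seg r a <o r'" using seg_ordLess[OF wo(1) that] 1(2) ordLess_ordIso_trans by blast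
    then obtain a' where "a' \<in> Field r'" "(seg r a, seg r' a') \<in> ordIso"
      using ordLess_iff_ordIso_Restr[OF wo(2) Well_order_seg[OF wo(1)], of a] by (auto simp: seg_def)
    then show ?thesis using 1(1)[OF seg_ordLess[OF wo(1) that]] by blast
  qed
  have b: "\<exists>a\<in>Field r. iterated_deriv D F (seg r a) = iterated_deriv D F (seg r' a')"
    if "a' \<in> Field r'" for a'
  proof -
    have "seg r' a' <o r"
      using seg_ordLess[OF wo(2) that] 1(2) ordLess_ordIso_trans ordIso_symmetric by blast
    then obtain a where a: "a \<in> Field r" "(seg r' a', seg r a) \<in> ordIso"
      using ordLess_iff_ordIso_Restr[OF wo(1) Well_order_seg[OF wo(2)], of a'] by (auto simp: seg_def)
    then show ?thesis using 1(1)[OF seg_ordLess[OF wo(1) a(1)]] ordIso_symmetric by blast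
  qed
  have "(\<lambda>a. iterated_deriv D F (seg r a)) ` Field r = (\<lambda>a. iterated_deriv D F (seg r' a)) ` Field r'"
    (is "?A = ?B")
  proof
    show "?A \<subseteq> ?B" using a by fast
    show "?B \<subseteq> ?A"
    proof clarify
      fix a' assume "a' \<in> Field r'"
      then show "iterated_deriv D F (seg r' a') \<in> ?A" using b[of a'] by (metis image_eqI)
    qed
  qed
  then have "D ` ?A = D ` ?B" by simp
  then have "F \<inter> \<Inter> (D ` ?A) = F \<inter> \<Inter> (D ` ?B)" by (rule arg_cong)
  then show ?case
    using iterated_deriv_eq[OF D wo(1), of F] iterated_deriv_eq[OF D wo(2), of F]
    unfolding image_image by (simp only:)
qed

text \<open>A point lost at one stage is absent from all later stages, since these lie inside the
  derivative of that stage. Points chosen from the successive losses are therefore distinct, and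
  \<open>F\<close> bounds the number of strict steps.\<close>

lemma strict_derivs_inj:
  assumes D: "\<And>A. D A \<subseteq> A" and wo: "Well_order z"
    and ne: "\<And>a. a \<in> Field z \<Longrightarrow> D (iterated_deriv D F (seg z a)) \<noteq> iterated_deriv D F (seg z a)"
  shows "\<exists>x. inj_on x (Field z) \<and> x ` Field z \<subseteq> F"
proof -
  let ?G = "\<lambda>a. iterated_deriv D F (seg z a)"
  have "\<forall>a\<in>Field z. \<exists>x. x \<in> ?G a - D (?G a)" using ne D by blast
  then obtain x where x: "\<And>a. a \<in> Field z \<Longrightarrow> x a \<in> ?G a - D (?G a)" by metis
  have neq: "x a \<noteq> x b" if "a \<in> underS z b" "b \<in> Field z" for a b
    using x[of a] x[of b] that iterated_deriv_seg[OF D wo, where F=F and a=b]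
      underS_subset_Field[OF that(1)] by auto
  have "inj_on x (Field z)"
    by (rule inj_onI) (metis neq Well_order_cases[OF wo])
  moreover have "x ` Field z \<subseteq> F"
    using x iterated_deriv_seg[OF D wo, where F=F] by blast
  ultimately show ?thesis by blast
qed

text \<open>Once a step removes nothing, no later step does, at successors or at limits.\<close>

lemma iterated_deriv_stationary:
  assumes D: "\<And>A. D A \<subseteq> A" and wo: "Well_order z" and a: "a \<in> Field z"
    and eq: "D (iterated_deriv D F (seg z a)) = iterated_deriv D F (seg z a)"
  shows "iterated_deriv D F z = iterated_deriv D F (seg z a)"
proof -
  let ?G = "\<lambda>a. iterated_deriv D F (seg z a)"
  have G: "?G b = F \<inter> (\<Inter>c\<in>underS z b. D (?G c))" for b
    using iterated_deriv_seg[OF D wo] .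
  have ge: "?G a \<subseteq> D (?G b)" if "b \<in> Field z" for b
    using that
  proof (induction b rule: wf_induct_rule[OF wo_rel.WF[unfolded wo_rel_def, OF wo]])
    case hyp: (1 b)
    consider "b \<in> underS z a" | "b = a" | "a \<in> underS z b"
      using Well_order_cases[OF wo hyp(2) a] by blast
    then show ?case
    proof cases
      case 1
      then show ?thesis using G[of a] by blast
    next
      case 2
      then show ?thesis using eq by simp
    next
      case 3
      have "?G a \<subseteq> D (?G c)" if "c \<in> underS z b" for c
        using hyp(1)[of c] that underS_subset_Field[OF that] by (auto simp: underS_def)
      then have "?G a \<subseteq> ?G b" by (subst (2) G) (use G[of a] in blast)
      moreover have "?G b \<subseteq> D (?G a)" by (subst G) (use 3 in blast)
      then have "?G b \<subseteq> ?G a" using eq by simp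
      ultimately have "?G a = ?G b" by simp
      then show ?thesis using eq by simp
    qed
  qed
  show ?thesis (is "?L = _")
  proof
    have "?L \<subseteq> D (?G a)" by (subst iterated_deriv_eq[OF D wo]) (use a in blast)
    then show "?L \<subseteq> ?G a" using eq by simp
    show "?G a \<subseteq> ?L" by (subst iterated_deriv_eq[OF D wo]) (use ge G[of a] in blast)
  qed
qed

text \<open>Here \<open>z\<close> lives on an arbitrary type, whereas \<open>deriv_index\<close>
  searches on the type of the elements of \<open>F\<close>. A minimal vanishing ordinal has only
  strict steps, so the points lost along it give an isomorphic copy on \<open>'s\<close>, which
  vanishes as well.\<close>

lemma deriv_index_props:
  fixes z :: "'c rel" and F :: "'s set"
  assumes D: "\<And>A. D A \<subseteq> A" and wo: "Well_order z" and e: "iterated_deriv D F z = {}"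
  shows "Well_order (deriv_index D F)" "iterated_deriv D F (deriv_index D F) = {}"
    "deriv_index D F \<le>o z"
proof -
  let ?R = "{\<alpha>::'c rel. Well_order \<alpha> \<and> iterated_deriv D F \<alpha> = {}}"
  obtain \<alpha> where \<alpha>: "\<alpha> \<in> ?R" "\<forall>r'\<in>?R. \<alpha> \<le>o r'"
    using exists_minim_Well_order[of ?R] wo e by blast
  have woa: "Well_order \<alpha>" using \<alpha> by simp
  have min: "iterated_deriv D F (seg \<alpha> a) \<noteq> {}" if "a \<in> Field \<alpha>" for a
    using \<alpha>(2) seg_ordLess[OF woa that] Well_order_seg[OF woa] not_ordLess_ordLeq by blast
  \<comment> \<open>A stalled step would freeze the iterate at a value that minimality of
    \<open>\<alpha>\<close> makes non-empty.\<close>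
  have "D (iterated_deriv D F (seg \<alpha> a)) \<noteq> iterated_deriv D F (seg \<alpha> a)" if "a \<in> Field \<alpha>" for a
    using iterated_deriv_stationary[OF D woa that, of F] \<alpha>(1) min[OF that] by auto
  then obtain x :: "'c \<Rightarrow> 's" where x: "inj_on x (Field \<alpha>)"
    using strict_derivs_inj[OF D woa, of F] by blast
  define \<beta> where "\<beta> = dir_image \<alpha> x"
  have \<beta>: "(\<alpha>, \<beta>) \<in> ordIso" "Well_order \<beta>"
    using dir_image_ordIso[OF woa x] Well_order_dir_image[OF woa x] by (auto simp: \<beta>_def)
  have Gb: "iterated_deriv D F \<beta> = {}" using iterated_deriv_ordIso[OF D \<beta>(1), of F] \<alpha>(1) by simp
  let ?P = "\<lambda>r :: 's rel. Well_order r \<and> iterated_deriv D F r = {} \<and>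
     (\<forall>r' :: 's rel. Well_order r' \<and> iterated_deriv D F r' = {} \<longrightarrow> r \<le>o r')"
  have "\<exists>r\<in>{r :: 's rel. Well_order r \<and> iterated_deriv D F r = {}}.
      \<forall>r'\<in>{r :: 's rel. Well_order r \<and> iterated_deriv D F r = {}}. r \<le>o r'"
    using Gb \<beta>(2) by (intro exists_minim_Well_order) auto
  then have "\<exists>r. ?P r" by auto
  then have P: "?P (deriv_index D F)" unfolding deriv_index_def by (rule someI_ex)
  then show "Well_order (deriv_index D F)" "iterated_deriv D F (deriv_index D F) = {}" by auto
  have "deriv_index D F \<le>o \<beta>" using P Gb \<beta>(2) by blast
  also have "\<beta> \<le>o \<alpha>" using \<beta>(1) ordIso_iff_ordLeq by blast
  also have "\<alpha> \<le>o z" using \<alpha>(2) wo e by blast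
  finally (ordLeq_transitive) show "deriv_index D F \<le>o z" .
qed

text \<open>A Hartogs-type argument: if a well-order of all of \<open>'s set\<close> failed to
  exhaust \<open>F\<close>, every step along it would be strict, and the lost points would inject
  \<open>'s set\<close> into \<open>'s\<close>, against Cantor.\<close>

lemma strict_deriv_terminates:
  fixes F :: "'s set"
  assumes D: "\<And>A. D A \<subseteq> A" and strict: "\<And>A. A \<subseteq> F \<Longrightarrow> A \<noteq> {} \<Longrightarrow> D A \<noteq> A"
  shows "Well_order (deriv_index D F)" "iterated_deriv D F (deriv_index D F) = {}"
proof -
  let ?z = "card_of (UNIV :: 's set set)"
  have wo: "Well_order ?z" by (rule card_of_Well_order)
  have "iterated_deriv D F ?z = {}"
  proof (rule ccontr)
    assume ne: "iterated_deriv D F ?z \<noteq> {}"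
    have "D (iterated_deriv D F (seg ?z a)) \<noteq> iterated_deriv D F (seg ?z a)" if "a \<in> Field ?z" for a
    proof (rule strict)
      show "iterated_deriv D F (seg ?z a) \<subseteq> F"
        using iterated_deriv_seg[OF D wo] by blast
      show "iterated_deriv D F (seg ?z a) \<noteq> {}"
        using ne iterated_deriv_eq[OF D wo, of F] D that by blast
    qed
    then obtain x :: "'s set \<Rightarrow> 's" where "inj_on x (Field ?z)"
      using strict_derivs_inj[OF D wo, of F] by blast
    then have "inj x" by (simp add: Field_card_of)
    then show False using Cantors_theorem[of "UNIV :: 's set"]
      by (metis Pow_UNIV inj_imp_surj_inv)
  qed
  then show "Well_order (deriv_index D F)" "iterated_deriv D F (deriv_index D F) = {}"
    using deriv_index_props[OF D wo] by auto
qed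

section \<open>Ordinal sums\<close>

lemma Field_ord_sum: "Field (ord_sum r q) = Inl ` Field r \<union> Inr ` Field q"
  unfolding ord_sum_def Field_def by (auto simp: image_iff)

lemma in_ord_sum [simp]:
  "(Inl a, Inl a') \<in> ord_sum r q \<longleftrightarrow> (a, a') \<in> r"
  "(Inr b, Inr b') \<in> ord_sum r q \<longleftrightarrow> (b, b') \<in> q"
  "(Inl a, Inr b) \<in> ord_sum r q \<longleftrightarrow> a \<in> Field r \<and> b \<in> Field q"
  "(Inr b, Inl a) \<notin> ord_sum r q"
  by (auto simp: ord_sum_def image_iff Bex_def)

lemma Well_order_ord_sum:
  assumes r: "Well_order r" and q: "Well_order q"
  shows "Well_order (ord_sum r q)"
proof -
  have R: "refl_on (Field r) r" "trans r" "antisym r" "total_on (Field r) r" "wf (r - Id)"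
    using r by (auto simp: order_on_defs)
  have Q: "refl_on (Field q) q" "trans q" "antisym q" "total_on (Field q) q" "wf (q - Id)"
    using q by (auto simp: order_on_defs)
  have "refl_on (Field (ord_sum r q)) (ord_sum r q)"
    using R(1) Q(1) unfolding refl_on_def Field_ord_sum by auto
  moreover have "trans (ord_sum r q)"
  proof (rule transI)
    fix x y z assume "(x, y) \<in> ord_sum r q" "(y, z) \<in> ord_sum r q"
    then show "(x, z) \<in> ord_sum r q"
      using R(2) Q(2) by (cases x; cases y; cases z) (auto dest: transD FieldI1 FieldI2)
  qed
  moreover have "antisym (ord_sum r q)"
  proof (rule antisymI)
    fix x y assume "(x, y) \<in> ord_sum r q" "(y, x) \<in> ord_sum r q"
    then show "x = y" using R(3) Q(3) by (cases x; cases y) (auto dest: antisymD)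
  qed
  moreover have "total_on (Field (ord_sum r q)) (ord_sum r q)"
    using R(4) Q(4) unfolding total_on_def Field_ord_sum by (auto; blast)
  moreover have "wf (ord_sum r q - Id)"
  proof (rule wfI_min)
    fix x and A :: "('a + 'b) set" assume x: "x \<in> A"
    show "\<exists>z\<in>A. \<forall>y. (y, z) \<in> ord_sum r q - Id \<longrightarrow> y \<notin> A"
    \<comment> \<open>Left elements precede all right ones, so the minimum is sought on the left
      whenever the set meets it.\<close>
    proof (cases "\<exists>a. Inl a \<in> A")
      case True
      then obtain a where "a \<in> {a. Inl a \<in> A}" by blast
      then obtain m where m: "m \<in> {a. Inl a \<in> A}" "\<And>y. (y, m) \<in> r - Id \<Longrightarrow> y \<notin> {a. Inl a \<in> A}"
        using wfE_min[OF R(5)] by metis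
      show ?thesis
      proof (intro bexI[of _ "Inl m"] allI impI)
        fix y assume "(y, Inl m) \<in> ord_sum r q - Id"
        then show "y \<notin> A" using m(2) by (cases y) auto
      qed (use m in auto)
    next
      case False
      then obtain b where "b \<in> {b. Inr b \<in> A}" using x by (cases x) auto
      then obtain m where m: "m \<in> {b. Inr b \<in> A}" "\<And>y. (y, m) \<in> q - Id \<Longrightarrow> y \<notin> {b. Inr b \<in> A}"
        using wfE_min[OF Q(5)] by metis
      show ?thesis
      proof (intro bexI[of _ "Inr m"] allI impI)
        fix y assume "(y, Inr m) \<in> ord_sum r q - Id"
        then show "y \<notin> A" using m(2) False by (cases y) auto
      qed (use m in auto)
    qed
  qed
  ultimately show ?thesis
    unfolding order_on_defs by (auto simp: refl_on_def intro: FieldI1 FieldI2)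
qed

lemma ordLess_ord_sum:
  assumes r: "Well_order r" and q: "Well_order q" and ne: "Field q \<noteq> {}"
  shows "r <o ord_sum r q"
proof -
  have "embed r (ord_sum r q) Inl"
  proof -
    have "under (ord_sum r q) (Inl a) = Inl ` under r a" for a
    proof -
      have "x \<in> under (ord_sum r q) (Inl a) \<longleftrightarrow> x \<in> Inl ` under r a" for x
        by (cases x) (auto simp: under_def)
      then show ?thesis by blast
    qed
    then show ?thesis by (auto simp: embed_def bij_betw_def)
  qed
  moreover have "\<not> bij_betw Inl (Field r) (Field (ord_sum r q))"
    using ne by (auto simp: bij_betw_def Field_ord_sum)
  ultimately show ?thesis
    using r Well_order_ord_sum[OF r q] by (auto simp: ordLess_def embedS_def)
qed

section \<open>The Szlenk derivation on the dual of an Asplund space\<close>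

text \<open>Banach-Alaoglu. The linear functions form a closed subset of the cube of the intervals
  \<open>{- norm x..norm x}\<close>, which is compact by Tychonoff, and \<open>Blinfun\<close>
  carries this set continuously onto the ball.\<close>

lemma compactin_strong_operator_cball:
  "compactin strong_operator_topology (cball (0 :: 'a::real_normed_vector \<Rightarrow>\<^sub>L real) 1)"
proof -
  define P where "P = (\<Pi>\<^sub>E x\<in>(UNIV::'a set). {- norm x..norm x})"
  define L where "L = {f\<in>P. (\<forall>x y. f (x + y) - f x - f y = 0) \<and> (\<forall>c x. f (c *\<^sub>R x) - c * f x = 0)}"
  have "compactin (product_topology (\<lambda>i. euclidean::real topology) UNIV) P"
    unfolding P_def by (subst compactin_PiE) (auto simp: compact_Icc)
  then have cP: "compact P" by (simp add: euclidean_product_topology)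
  have "L = P \<inter> (\<Inter>x y. {f. f (x + y) - f x - f y = 0}) \<inter> (\<Inter>c x. {f. f (c *\<^sub>R x) - c * f x = 0})"
    by (auto simp: L_def)
  moreover have "closed (\<Inter>x y. {f :: 'a \<Rightarrow> real. f (x + y) - f x - f y = 0})"
    by (intro closed_INT ballI closed_Collect_eq continuous_intros) (auto intro: continuous_on_product_coordinates)
  moreover have "closed (\<Inter>c x. {f :: 'a \<Rightarrow> real. f (c *\<^sub>R x) - c * f x = 0})"
    by (intro closed_INT ballI closed_Collect_eq continuous_intros) (auto intro: continuous_on_product_coordinates)
  ultimately have cL: "compact L"
    using cP by (simp add: compact_Int_closed)
  have bl: "bounded_linear f" "\<And>x. \<bar>f x\<bar> \<le> norm x" if "f \<in> L" for f
  proof -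
    show b: "\<bar>f x\<bar> \<le> norm x" for x
    proof -
      have "f x \<in> {- norm x..norm x}"
        using that unfolding L_def P_def PiE_UNIV_domain by blast
      then show ?thesis by (simp add: abs_le_iff)
    qed
    show "bounded_linear f"
    proof (rule bounded_linear_intro[where K=1])
      fix x y c
      have "f (x + y) - f x - f y = 0" "f (c *\<^sub>R x) - c * f x = 0"
        using that unfolding L_def by blast+
      then show "f (x + y) = f x + f y" "f (c *\<^sub>R x) = c *\<^sub>R f x" by simp_all
    qed (use b in simp)
  qed
  have eq: "blinfun_apply (Blinfun f) = f" if "f \<in> L" for f
    using bl(1)[OF that] by (simp add: bounded_linear_Blinfun_apply)
  have "continuous_map (top_of_set L) strong_operator_topology Blinfun"
    unfolding continuous_on_strong_operator_topo_iff_coordinatewise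
  proof
    fix x
    have "continuous_on L (\<lambda>f. f x)"
      by (rule continuous_on_subset[OF continuous_on_product_coordinates]) simp
    then have "continuous_on L (\<lambda>f. blinfun_apply (Blinfun f) x)"
      by (rule continuous_on_eq) (simp add: eq)
    then show "continuous_map (top_of_set L) euclidean (\<lambda>f. blinfun_apply (Blinfun f) x)"
      by simp
  qed
  then have "compactin strong_operator_topology (Blinfun ` L)"
    by (rule image_compactin[rotated]) (use cL in \<open>auto simp: compactin_subtopology\<close>)
  moreover have "Blinfun ` L = cball 0 1"
  proof
    show "Blinfun ` L \<subseteq> cball 0 1"
      using bl(2) by (auto simp: eq intro!: norm_blinfun_bound)
    show "cball 0 1 \<subseteq> Blinfun ` L"
    proof
      fix f :: "'a \<Rightarrow>\<^sub>L real" assume f: "f \<in> cball 0 1"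
      have b: "\<bar>f x\<bar> \<le> norm x" for x
        using norm_blinfun[of f x] mult_right_mono[of "norm f" 1 "norm x"] f by simp
      have bb: "- norm x \<le> f x" "f x \<le> norm x" for x
        using b[of x] by linarith+
      have "blinfun_apply f \<in> L"
        using bb
        by (auto simp: L_def P_def blinfun.add_right blinfun.scaleR_right)
      then show "f \<in> Blinfun ` L" by (metis blinfun_apply_inverse image_eqI)
    qed
  qed
  ultimately show ?thesis by simp
qed

text \<open>No absolute value is needed around \<open>f x\<close> because the unit ball is
  symmetric: testing the normalised vector and its negative bounds the norm by
  \<open>c\<close>.\<close>

lemma blinfun_norm_witness:
  fixes f :: "'a::real_normed_vector \<Rightarrow>\<^sub>L real"
  assumes "c < norm f" "0 \<le> c"
  obtains x where "norm x \<le> 1" "c < f x"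
proof -
  have "\<exists>x. norm x \<le> 1 \<and> c < f x"
  proof (rule ccontr)
    assume "\<nexists>x. norm x \<le> 1 \<and> c < f x"
    then have le: "f x \<le> c" if "norm x \<le> 1" for x using that by (meson not_le)
    have "norm (f x) \<le> c * norm x" for x
    proof (cases "x = 0")
      case False
      then have "f ((1 / norm x) *\<^sub>R x) \<le> c" "f ((- (1 / norm x)) *\<^sub>R x) \<le> c"
        by (intro le; simp)+
      then show ?thesis
        using False unfolding blinfun.scaleR_right by (auto simp: field_simps abs_le_iff)
    qed simp
    then have "norm f \<le> c" by (rule norm_blinfun_bound[OF assms(2)])
    then show False using assms by simp
  qed
  then show ?thesis using that by blast
qed

lemma separable_space_span:
  fixes B :: "'a::real_normed_vector set"
  assumes "countable B"
  shows "separable_space (top_of_set (span B))"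
proof -
  \<comment> \<open>Rational combinations coded as lists, so that countability is inherited from
    lists over a countable set.\<close>
  define F where "F = (\<lambda>l :: (rat \<times> 'a) list. \<Sum>(q, b)\<leftarrow>l. (of_rat q :: real) *\<^sub>R b)"
  define C where "C = F ` lists (UNIV \<times> B)"
  have C: "countable C" unfolding C_def using assms by (intro countable_image countable_lists) auto
  have "F l \<in> span B" if "l \<in> lists (UNIV \<times> B)" for l
    using that by (induction l) (auto simp: F_def span_zero intro!: span_add span_scale intro: span_base)
  then have sub: "C \<subseteq> span B" by (auto simp: C_def)
  have dense: "\<forall>e>0. \<exists>c\<in>C. dist c v < e" if "v \<in> span B" for v
    using that
  proof (induction rule: span_induct_alt)
    case base
    have "F [] \<in> C" unfolding C_def by blast
    then show ?case by (auto simp: F_def intro!: bexI[of _ 0])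
  next
    case (step c x y)
    show ?case
    proof (intro allI impI)
      fix e :: real assume e: "e > 0"
      obtain l where l: "l \<in> lists (UNIV \<times> B)" "dist (F l) y < e / 2"
      proof -
        obtain c' where "c' \<in> C" "dist c' y < e / 2" using step(2) half_gt_zero[OF e] by blast
        then show ?thesis using that unfolding C_def by blast
      qed
      \<comment> \<open>Replacing \<open>c\<close> by a rational within \<open>d\<close> costs at
        most e/2; the summand 1 keeps the denominator positive when \<open>x\<close> is
        zero.\<close>
      define d where "d = e / (2 * (norm x + 1))"
      have d: "d > 0" using e by (simp add: d_def add_nonneg_pos)
      then obtain q where q: "q \<in> \<rat>" "c < q" "q < c + d"
        using Rats_dense_in_real[of c "c + d"] by auto
      then obtain p where p: "q = of_rat p" by (auto elim: Rats_cases)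
      have "norm ((q - c) *\<^sub>R x) \<le> d * norm x"
        using q by (auto intro: mult_right_mono)
      also have "\<dots> \<le> d * (norm x + 1)" using d by simp
      also have "\<dots> = e / 2"
      proof -
        have "norm x + 1 \<noteq> 0" using norm_ge_zero[of x] by linarith
        moreover have "e / (2 * m) * m = e / 2" if "m \<noteq> 0" for m :: real using that by simp
        ultimately show ?thesis unfolding d_def by blast
      qed
      finally have le: "norm ((q - c) *\<^sub>R x) \<le> e / 2" .
      have eq: "F ((p, x) # l) - (c *\<^sub>R x + y) = (q - c) *\<^sub>R x + (F l - y)"
        by (simp add: F_def p algebra_simps)
      have "norm (F ((p, x) # l) - (c *\<^sub>R x + y)) < e"
        unfolding eq using l(2) le norm_triangle_ineq[of "(q - c) *\<^sub>R x" "F l - y"]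
        unfolding dist_norm by linarith
      moreover have "F ((p, x) # l) \<in> C" using l(1) step(1) by (auto simp: C_def)
      ultimately show "\<exists>c'\<in>C. dist c' (c *\<^sub>R x + y) < e" by (auto simp: dist_norm)
    qed
  qed
  have "top_of_set (span B) closure_of C = span B"
  proof -
    have "span B \<subseteq> closure C" using dense by (auto simp: closure_approachable)
    then show ?thesis using sub by (simp add: closure_of_subtopology inf_absorb2 inf_absorb1)
  qed
  then show ?thesis unfolding separable_space_def using C sub by auto
qed

section \<open>Strict decrease of the Szlenk derivation\<close>

lemma szlenk_deriv_subset: "szlenk_deriv e F \<subseteq> F"
  by (auto simp: szlenk_deriv_def)

lemma openin_strong_operator_halfspaces:
  fixes x :: "'a::real_normed_vector"
  shows "openin strong_operator_topology {f :: 'a \<Rightarrow>\<^sub>L real. c < f x}"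
    and "openin strong_operator_topology {f :: 'a \<Rightarrow>\<^sub>L real. f x < c}"
    and "closedin strong_operator_topology {f :: 'a \<Rightarrow>\<^sub>L real. c \<le> f x}"
    and "closedin strong_operator_topology {f :: 'a \<Rightarrow>\<^sub>L real. f x \<le> c}"
proof -
  note c = strong_operator_topology_continuous_evaluation[of x, where 'b=real]
  show "openin strong_operator_topology {f :: 'a \<Rightarrow>\<^sub>L real. c < f x}"
    using openin_continuous_map_preimage[OF c, of "{c<..}"] by (simp add: strong_operator_topology_topspace)
  show "openin strong_operator_topology {f :: 'a \<Rightarrow>\<^sub>L real. f x < c}"
    using openin_continuous_map_preimage[OF c, of "{..<c}"] by (simp add: strong_operator_topology_topspace)
  show "closedin strong_operator_topology {f :: 'a \<Rightarrow>\<^sub>L real. c \<le> f x}"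
    using closedin_continuous_map_preimage[OF c, of "{c..}"] by (simp add: strong_operator_topology_topspace)
  show "closedin strong_operator_topology {f :: 'a \<Rightarrow>\<^sub>L real. f x \<le> c}"
    using closedin_continuous_map_preimage[OF c, of "{..c}"] by (simp add: strong_operator_topology_topspace)
qed

text \<open>When nothing is removed, every non-empty slice of \<open>A\<close> has diameter at least
  \<open>e\<close>. Two distant functionals in it are told apart by a vector of the unit ball, and
  the gap persists on small weak-star neighbourhoods of both.\<close>

lemma szlenk_split:
  fixes A :: "('a::real_normed_vector \<Rightarrow>\<^sub>L real) set"
  assumes A: "szlenk_deriv e A = A" and e: "e > 0"
    and U: "openin strong_operator_topology U" "U \<inter> A \<noteq> {}"
  shows "\<exists>x c U0 U1. norm x \<le> 1 \<and> openin strong_operator_topology U0 \<and>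
    openin strong_operator_topology U1 \<and> U0 \<subseteq> U \<and> U1 \<subseteq> U \<and> U0 \<inter> A \<noteq> {} \<and> U1 \<inter> A \<noteq> {} \<and>
    (\<forall>f\<in>U0. c + e / 4 \<le> f x) \<and> (\<forall>f\<in>U1. f x \<le> c)"
proof -
  obtain \<xi> where "\<xi> \<in> U \<inter> A" using U by blast
  then have "\<xi> \<in> szlenk_deriv e A" "\<xi> \<in> U" using A by auto
  then have diam: "e \<le> diameter (U \<inter> A)" using U by (auto simp: szlenk_deriv_def)
  \<comment> \<open>A supremum need not be attained, so only a pair at distance above e/2 is
    claimed.\<close>
  have "\<exists>f\<in>U \<inter> A. \<exists>g\<in>U \<inter> A. e / 2 < dist f g"
  proof (rule ccontr)
    assume "\<not> ?thesis"
    then have "diameter (U \<inter> A) \<le> e / 2"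
      using e by (intro diameter_le) (auto simp: not_less dist_norm)
    then show False using diam e by simp
  qed
  then obtain f g where fg: "f \<in> U \<inter> A" "g \<in> U \<inter> A" "e / 2 < norm (f - g)"
    by (auto simp: dist_norm)
  obtain x where x: "norm x \<le> 1" "e / 2 < blinfun_apply (f - g) x"
    using blinfun_norm_witness[OF fg(3)] e by auto
  \<comment> \<open>The vector \<open>x\<close> separates \<open>f\<close> and \<open>g\<close> by
    more than e/2; giving up e/8 on each side leaves the uniform gap e/4.\<close>
  define U0 where "U0 = U \<inter> {h. f x - e / 8 < blinfun_apply h x}"
  define U1 where "U1 = U \<inter> {h. blinfun_apply h x < g x + e / 8}"
  have "openin strong_operator_topology U0" "openin strong_operator_topology U1"
    unfolding U0_def U1_def by (intro openin_Int U openin_strong_operator_halfspaces)+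
  moreover have "f \<in> U0 \<inter> A" "g \<in> U1 \<inter> A" using fg e by (auto simp: U0_def U1_def)
  moreover have "\<forall>h\<in>U0. (g x + e / 8) + e / 4 \<le> blinfun_apply h x"
    using x(2) by (auto simp: U0_def blinfun.diff_left)
  moreover have "\<forall>h\<in>U1. blinfun_apply h x \<le> g x + e / 8"
    by (auto simp: U1_def)
  moreover have "U0 \<subseteq> U" "U1 \<subseteq> U" by (auto simp: U0_def U1_def)
  ultimately show ?thesis using x(1) by blast
qed

lemma subspace_dual_restrict:
  assumes "subspace M"
  shows "restrict (blinfun_apply f) M \<in> subspace_dual M"
proof -
  have "\<bar>f x\<bar> \<le> norm f * norm x" for x using norm_blinfun[of f x] by simp
  then show ?thesis using assms
    by (auto simp: subspace_dual_def subspace_def blinfun.add_right blinfun.scaleR_right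
        intro!: exI[of _ "norm f"])
qed

lemma subspace_dual_dist_upper:
  assumes "f \<in> subspace_dual M" "g \<in> subspace_dual M" "x \<in> M" "norm x \<le> 1"
  shows "\<bar>f x - g x\<bar> \<le> subspace_dual_dist M f g"
  unfolding subspace_dual_dist_def
proof (rule cSUP_upper)
  show "x \<in> {x \<in> M. norm x \<le> 1}" using assms by simp
  obtain B1 where B1: "\<forall>x\<in>M. \<bar>f x\<bar> \<le> B1 * norm x" using assms by (auto simp: subspace_dual_def)
  obtain B2 where B2: "\<forall>x\<in>M. \<bar>g x\<bar> \<le> B2 * norm x" using assms by (auto simp: subspace_dual_def)
  show "bdd_above ((\<lambda>x. \<bar>f x - g x\<bar>) ` {x \<in> M. norm x \<le> 1})"
  proof (rule bdd_aboveI2)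
    fix y assume y: "y \<in> {x \<in> M. norm x \<le> 1}"
    \<comment> \<open>The constants in \<open>subspace_dual\<close> may be negative when
      \<open>M\<close> is trivial, hence the absolute values.\<close>
    have "B1 * norm y \<le> \<bar>B1\<bar>" "B2 * norm y \<le> \<bar>B2\<bar>"
      using y by (smt (verit) mem_Collect_eq mult_left_le mult_right_mono norm_ge_zero)+
    then show "\<bar>f y - g y\<bar> \<le> \<bar>B1\<bar> + \<bar>B2\<bar>"
      using B1 B2 y by (smt (verit) mem_Collect_eq)
  qed
qed

lemma uncountable_nat_bool: "uncountable (UNIV :: (nat \<Rightarrow> bool) set)"
proof
  assume "countable (UNIV :: (nat \<Rightarrow> bool) set)"
  then obtain f :: "nat \<Rightarrow> nat \<Rightarrow> bool" where f: "range f = UNIV"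
    using range_from_nat_into[of "UNIV :: (nat \<Rightarrow> bool) set"]
      \<open>countable UNIV\<close> by (metis UNIV_not_empty)
  then obtain n where "f n = (\<lambda>k. \<not> f k k)" by (metis surjD)
  then show False by (metis)
qed

text \<open>If nothing were removed from \<open>A\<close>, repeated splitting would give a Cantor scheme of weak* open sets,
  and by weak* compactness one functional for each branch. These functionals are \<open>e / 4\<close>-separated on
  the span of the countably many vectors used for splitting, whose dual is separable.\<close>

lemma szlenk_deriv_neq:
  fixes A :: "('a::banach \<Rightarrow>\<^sub>L real) set"
  assumes asp: "asplund TYPE('a)" and e: "e > 0" and ball: "A \<subseteq> cball 0 1" and ne: "A \<noteq> {}"
  shows "szlenk_deriv e A \<noteq> A"
proof
  assume A: "szlenk_deriv e A = A"
  let ?S = "strong_operator_topology :: ('a \<Rightarrow>\<^sub>L real) topology"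
  let ?ok = "\<lambda>U. openin ?S U \<and> U \<inter> A \<noteq> {}"
  have "\<exists>x c U0 U1. ?ok U \<longrightarrow> norm x \<le> 1 \<and> ?ok U0 \<and> ?ok U1 \<and> U0 \<subseteq> U \<and> U1 \<subseteq> U \<and>
     (\<forall>f\<in>U0. c + e / 4 \<le> blinfun_apply f x) \<and> (\<forall>f\<in>U1. blinfun_apply f x \<le> c)" for U
    using szlenk_split[OF A e, of U] by blast
  then obtain X c U0 U1 where st: "\<And>U. ?ok U \<Longrightarrow> norm (X U) \<le> 1 \<and> ?ok (U0 U) \<and> ?ok (U1 U) \<and>
     U0 U \<subseteq> U \<and> U1 U \<subseteq> U \<and>
     (\<forall>f\<in>U0 U. c U + e / 4 \<le> blinfun_apply f (X U)) \<and> (\<forall>f\<in>U1 U. blinfun_apply f (X U) \<le> c U)"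
    by metis
  \<comment> \<open>The newest bit stands at the head of a word, so \<open>pre \<beta> n\<close>
    below lists the first \<open>n\<close> bits of a branch in reverse order.\<close>
  define W where "W = rec_list UNIV (\<lambda>b (s :: bool list) U. if b then U0 U else U1 U)"
  have W: "W [] = UNIV" "W (b # s) = (if b then U0 (W s) else U1 (W s))" for b s
    by (auto simp: W_def)
  have ok: "?ok (W s)" for s
  proof (induction s)
    case Nil
    have "openin ?S UNIV" using openin_topspace[of ?S] by (simp add: strong_operator_topology_topspace)
    then show ?case using ne by (simp add: W)
  next
    case (Cons b s)
    then show ?case using st[OF Cons] by (simp add: W)
  qed
  define pre where "pre \<beta> n = map \<beta> (rev [0..<n])" for \<beta> :: "nat \<Rightarrow> bool" and n
  have pre: "pre \<beta> (Suc n) = \<beta> n # pre \<beta> n" for \<beta> n by (simp add: pre_def)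
  \<comment> \<open>\<open>A\<close> need not be weak-star closed. The limit functionals are found
    in closures within the ball and need not belong to \<open>A\<close>.\<close>
  let ?X = "subtopology ?S (cball 0 1)"
  have cX: "compact_space ?X"
    using compactin_strong_operator_cball[where 'a='a] by (simp add: compactin_subspace)
  have tX: "topspace ?X = cball 0 1" by (simp add: strong_operator_topology_topspace)
  have "\<exists>h. \<forall>n. h \<in> ?X closure_of (W (pre \<beta> n) \<inter> A)" for \<beta>
  proof -
    have "(\<Inter>n. ?X closure_of (W (pre \<beta> n) \<inter> A)) \<noteq> {}"
    proof (rule compact_space_imp_nest[OF cX])
      show "?X closure_of (W (pre \<beta> n) \<inter> A) \<noteq> {}" for n
        using closure_of_subset[of "W (pre \<beta> n) \<inter> A" ?X] ok[of "pre \<beta> n"] ball tX by blast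
      have "W (pre \<beta> (Suc n)) \<subseteq> W (pre \<beta> n)" for n
        using st[OF ok[of "pre \<beta> n"]] by (simp add: W pre)
      then have "?X closure_of (W (pre \<beta> (Suc n)) \<inter> A) \<subseteq> ?X closure_of (W (pre \<beta> n) \<inter> A)" for n
        by (intro closure_of_mono) auto
      then show "decseq (\<lambda>n. ?X closure_of (W (pre \<beta> n) \<inter> A))" by (simp add: decseq_Suc_iff)
    qed simp
    then show ?thesis by blast
  qed
  then obtain h where h: "\<And>\<beta> n. h \<beta> \<in> ?X closure_of (W (pre \<beta> n) \<inter> A)" by metis
  \<comment> \<open>The split was stated with non-strict inequalities, which define closed
    half-spaces and so survive the passage to closures.\<close>
  have h1: "c (W (pre \<beta> n)) + e / 4 \<le> h \<beta> (X (W (pre \<beta> n)))" if "\<beta> n" for \<beta> n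
  proof -
    let ?H = "{f. c (W (pre \<beta> n)) + e / 4 \<le> blinfun_apply f (X (W (pre \<beta> n)))}"
    have "W (pre \<beta> (Suc n)) \<subseteq> ?H" using st[OF ok[of "pre \<beta> n"]] that by (auto simp: W pre)
    then have "?X closure_of (W (pre \<beta> (Suc n)) \<inter> A) \<subseteq> ?H \<inter> cball 0 1"
      using ball by (intro closure_of_minimal)
        (auto simp: closedin_subtopology intro!: exI[of _ ?H] openin_strong_operator_halfspaces)
    then show ?thesis using h[of \<beta> "Suc n"] by blast
  qed
  have h0: "h \<beta> (X (W (pre \<beta> n))) \<le> c (W (pre \<beta> n))" if "\<not> \<beta> n" for \<beta> n
  proof -
    let ?H = "{f. blinfun_apply f (X (W (pre \<beta> n))) \<le> c (W (pre \<beta> n))}"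
    have "W (pre \<beta> (Suc n)) \<subseteq> ?H" using st[OF ok[of "pre \<beta> n"]] that by (auto simp: W pre)
    then have "?X closure_of (W (pre \<beta> (Suc n)) \<inter> A) \<subseteq> ?H \<inter> cball 0 1"
      using ball by (intro closure_of_minimal)
        (auto simp: closedin_subtopology intro!: exI[of _ ?H] openin_strong_operator_halfspaces)
    then show ?thesis using h[of \<beta> "Suc n"] by blast
  qed
  \<comment> \<open>There are countably many words and hence countably many splitting vectors, so
    \<open>M\<close> is separable although the branches are uncountably many.\<close>
  define M where "M = span (range (\<lambda>s. X (W s)))"
  have M: "subspace M" "X (W s) \<in> M" "norm (X (W s)) \<le> 1" for s
    using st[OF ok[of s]] by (auto simp: M_def intro: span_base)
  have "separable_space (top_of_set M)"
    unfolding M_def by (rule separable_space_span) auto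
  then have "separable_dual M" using asp M(1) by (auto simp: asplund_def)
  then obtain D where D: "countable D" "D \<subseteq> subspace_dual M"
    "\<And>f d. f \<in> subspace_dual M \<Longrightarrow> d > 0 \<Longrightarrow> \<exists>g\<in>D. subspace_dual_dist M f g < d"
    unfolding separable_dual_def by blast
  \<comment> \<open>Two functionals e/4 apart at some vector of the unit ball cannot both be within
    less than e/8 of the same \<open>g\<close>.\<close>
  have "\<exists>g\<in>D. subspace_dual_dist M (restrict (h \<beta>) M) g < e / 8" for \<beta>
    using D(3)[OF subspace_dual_restrict[OF M(1)], of "e / 8"] e by auto
  then obtain g where g: "\<And>\<beta>. g \<beta> \<in> D" "\<And>\<beta>. subspace_dual_dist M (restrict (h \<beta>) M) (g \<beta>) < e / 8"
    by metis
  have close: "\<bar>h \<beta> (X (W s)) - g \<beta> (X (W s))\<bar> < e / 8" for \<beta> s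
    using subspace_dual_dist_upper[OF subspace_dual_restrict[OF M(1)] _ M(2,3), of "g \<beta>" "h \<beta>" s]
      g[of \<beta>] D(2) M(2) by auto
  have "inj g"
  proof (rule injI, rule ccontr)
    fix \<beta> \<gamma> assume eq: "g \<beta> = g \<gamma>" and "\<beta> \<noteq> \<gamma>"
    \<comment> \<open>Up to the first bit where they differ, both branches follow the same word and
      therefore use the same splitting vector.\<close>
    define n where "n = (LEAST n. \<beta> n \<noteq> \<gamma> n)"
    obtain m where "\<beta> m \<noteq> \<gamma> m" using \<open>\<beta> \<noteq> \<gamma>\<close> by blast
    then have n: "\<beta> n \<noteq> \<gamma> n" unfolding n_def by (rule LeastI)
    have "\<beta> k = \<gamma> k" if "k < n" for k using that not_less_Least unfolding n_def by blast
    then have same: "pre \<beta> n = pre \<gamma> n" by (auto simp: pre_def)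
    let ?s = "pre \<beta> n"
    have "e / 4 \<le> \<bar>h \<beta> (X (W ?s)) - h \<gamma> (X (W ?s))\<bar>"
    proof (cases "\<beta> n")
      case True
      then show ?thesis using n h1[of \<beta> n] h0[of \<gamma> n] unfolding same[symmetric] by linarith
    next
      case False
      then show ?thesis using n h0[of \<beta> n] h1[of \<gamma> n] unfolding same[symmetric] by linarith
    qed
    moreover have "\<bar>h \<gamma> (X (W ?s)) - g \<beta> (X (W ?s))\<bar> < e / 8"
      using close[of \<gamma> ?s] unfolding eq .
    ultimately show False using close[of \<beta> ?s] e by linarith
  qed
  moreover have "range g \<subseteq> D" using g(1) by blast
  ultimately have "countable (UNIV :: (nat \<Rightarrow> bool) set)"
    using D(1) countable_image_inj_on countable_subset by blast
  then show False using uncountable_nat_bool by simp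
qed

lemma szlenk_index_props:
  assumes "asplund TYPE('a::banach)" "e > 0"
  shows "Well_order (szlenk_index TYPE('a) e)"
    "iterated_deriv (szlenk_deriv e) (cball (0 :: 'a \<Rightarrow>\<^sub>L real) 1) (szlenk_index TYPE('a) e) = {}"
proof -
  note * = strict_deriv_terminates[where D="szlenk_deriv e" and F="cball (0 :: 'a \<Rightarrow>\<^sub>L real) 1",
      OF szlenk_deriv_subset szlenk_deriv_neq[OF assms]]
  show "Well_order (szlenk_index TYPE('a) e)"
    unfolding szlenk_index_def by (rule *(1))
  show "iterated_deriv (szlenk_deriv e) (cball (0 :: 'a \<Rightarrow>\<^sub>L real) 1) (szlenk_index TYPE('a) e) = {}"
    unfolding szlenk_index_def by (rule *(2))
qed

section \<open>Tree topologies\<close>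

lemma finite_chain_greatest:
  assumes "finite A" "A \<noteq> {}" "total_on A r" "trans r" "\<And>a. a \<in> A \<Longrightarrow> (a, a) \<in> r"
  shows "\<exists>m\<in>A. \<forall>a\<in>A. (a, m) \<in> r"
  using assms
proof (induction A rule: finite_ne_induct)
  case (insert x F)
  then obtain m where m: "m \<in> F" "\<forall>a\<in>F. (a, m) \<in> r"
    by (metis (no_types, lifting) insertCI total_on_subset subset_insertI)
  have "(x, m) \<in> r \<or> (m, x) \<in> r"
    using insert.prems(1,3) m(1) unfolding total_on_def by (metis insertCI)
  then show ?case
  proof
    assume "(x, m) \<in> r"
    then show ?thesis using m by blast
  next
    assume mx: "(m, x) \<in> r"
    have "(a, x) \<in> r" if "a \<in> F" for a using transD[OF insert.prems(2) _ mx] m(2) that by blast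
    then show ?thesis using insert.prems(3)[of x] by blast
  qed
qed simp

locale tree_space =
  fixes T :: "'t set" and r :: "'t rel"
  assumes tree: "tree T r"
begin

abbreviation "U \<equiv> tree_nbhd T r"
abbreviation "K \<equiv> tree_topology T r"

definition basic :: "'t \<Rightarrow> 't set \<Rightarrow> 't set set" where
  "basic t E = U t - (\<Union>s\<in>E. U s)"

lemma
  shows le_refl: "t \<in> T \<Longrightarrow> (t, t) \<in> r"
    and le_trans: "(s, t) \<in> r \<Longrightarrow> (t, u) \<in> r \<Longrightarrow> (s, u) \<in> r"
    and le_antisym: "(s, t) \<in> r \<Longrightarrow> (t, s) \<in> r \<Longrightarrow> s = t"
    and le_in: "(s, t) \<in> r \<Longrightarrow> s \<in> T \<and> t \<in> T"
    and finite_under: "t \<in> T \<Longrightarrow> finite (under r t)"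
  using tree unfolding tree_def partial_order_on_def preorder_on_def refl_on_def trans_def antisym_def
  by blast+

lemma trans_r: "trans r"
  using le_trans by (auto intro: transI)

lemma below_comparable: "(s, u) \<in> r \<Longrightarrow> (t, u) \<in> r \<Longrightarrow> (s, t) \<in> r \<or> (t, s) \<in> r"
proof -
  assume a: "(s, u) \<in> r" "(t, u) \<in> r"
  then have "total_on {b. (b, u) \<in> r} r"
    using tree le_in[of s u] unfolding tree_def under_def by blast
  then have "s \<noteq> t \<longrightarrow> (s, t) \<in> r \<or> (t, s) \<in> r"
    using a unfolding total_on_def by blast
  then show ?thesis using le_refl[of s] le_in[OF a(1)] by blast
qed

lemma direct_pred_exists:
  assumes "(s, t) \<in> r" "s \<noteq> t"
  obtains p where "direct_pred r p t" "(s, p) \<in> r"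
proof -
  have "finite (underS r t)"
    using finite_under[of t] le_in[OF assms(1)] by (rule_tac finite_subset) (auto simp: under_def underS_def)
  moreover have "underS r t \<noteq> {}" using assms by (auto simp: underS_def)
  moreover have "total_on (underS r t) r"
    using below_comparable by (auto simp: total_on_def underS_def)
  ultimately obtain m where "m \<in> underS r t" "\<forall>a\<in>underS r t. (a, m) \<in> r"
    using finite_chain_greatest[OF _ _ _ trans_r, of "underS r t"] le_refl le_in
    by (metis (no_types, lifting) mem_Collect_eq underS_def)
  then show ?thesis using that[of m] assms by (auto simp: direct_pred_def underS_def)
qed

text \<open>The child is the least node strictly above \<open>t\<close> on the finite chain leading
  to \<open>e\<close>, obtained as a greatest element for the converse order.\<close>

lemma child_exists:
  assumes "(t, e) \<in> r" "t \<noteq> e"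
  obtains c where "direct_pred r t c" "(c, e) \<in> r"
proof -
  let ?A = "{u\<in>under r e. (t, u) \<in> r \<and> t \<noteq> u}"
  have "finite ?A" using finite_under[of e] le_in[OF assms(1)] by auto
  moreover have "e \<in> ?A" using assms le_refl le_in[OF assms(1)] by (auto simp: under_def)
  moreover have "total_on ?A (r\<inverse>)"
    using below_comparable by (auto simp: total_on_def under_def)
  moreover have "trans (r\<inverse>)" using trans_r by simp
  moreover have "(a, a) \<in> r\<inverse>" if "a \<in> ?A" for a using that le_refl le_in by auto
  ultimately obtain c where c: "c \<in> ?A" "\<forall>a\<in>?A. (a, c) \<in> r\<inverse>"
    using finite_chain_greatest[of ?A "r\<inverse>"] by blast
  have "(u, t) \<in> r" if u: "u \<in> underS r c" for u
  proof (rule ccontr)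
    assume n: "(u, t) \<notin> r"
    have "(u, e) \<in> r" using u c(1) le_trans by (auto simp: under_def underS_def)
    then have "u \<in> ?A" using n below_comparable[OF _ assms(1), of u] le_refl[of t] le_in[OF assms(1)]
      by (auto simp: under_def)
    then have "(c, u) \<in> r" using c by auto
    then show False using u le_antisym by (auto simp: underS_def)
  qed
  then have "direct_pred r t c" using c(1) by (auto simp: direct_pred_def underS_def)
  then show ?thesis using c(1) that by (auto simp: under_def)
qed

lemma branchD:
  assumes "b \<in> branches T r"
  shows "b \<noteq> {}" "b \<subseteq> T" "s \<in> b \<Longrightarrow> t \<in> b \<Longrightarrow> (s, t) \<in> r \<or> (t, s) \<in> r"
    "direct_pred r s t \<Longrightarrow> t \<in> b \<Longrightarrow> s \<in> b"
proof -
  have *: "b \<noteq> {}" "b \<subseteq> T" "total_on b r" "\<forall>t\<in>b. \<forall>s. direct_pred r s t \<longrightarrow> s \<in> b"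
    using assms by (auto simp: branches_def)
  show "b \<noteq> {}" "b \<subseteq> T" by fact+
  show "(s, t) \<in> r \<or> (t, s) \<in> r" if "s \<in> b" "t \<in> b"
    by (cases "s = t") (use *(2,3) le_refl[of s] that in \<open>auto simp: total_on_def\<close>)
  show "s \<in> b" if "direct_pred r s t" "t \<in> b" using *(4) that by blast
qed

lemma under_psubset:
  assumes "(s, t) \<in> r" "s \<noteq> t" shows "under r s \<subset> under r t"
proof
  show "under r s \<subseteq> under r t" using le_trans[OF _ assms(1)] by (auto simp: under_def)
  show "under r s \<noteq> under r t"
    using le_antisym[OF assms(1)] assms(2) le_refl[of t] le_in[OF assms(1)] by (auto simp: under_def)
qed

text \<open>Branches are closed under direct predecessors by definition; finiteness of
  \<open>under r t\<close> lets finitely many such steps reach any smaller node.\<close>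

lemma branch_downward:
  assumes b: "b \<in> branches T r"
  shows "t \<in> b \<Longrightarrow> (s, t) \<in> r \<Longrightarrow> s \<in> b"
proof (induction "card (under r t)" arbitrary: t rule: less_induct)
  case less
  show ?case
  proof (cases "s = t")
    case False
    then obtain p where p: "direct_pred r p t" "(s, p) \<in> r"
      using direct_pred_exists less.prems(2) by blast
    then have pt: "(p, t) \<in> r" "p \<noteq> t" by (auto simp: direct_pred_def underS_def)
    have "under r p \<subset> under r t"
      by (rule under_psubset[OF pt])
    then have "card (under r p) < card (under r t)"
      using finite_under le_in[OF pt(1)] by (intro psubset_card_mono) auto
    then show ?thesis using less.hyps[of p] branchD(4)[OF b p(1)] less.prems(1) p(2) by blast
  qed (use less in simp)
qed

lemma under_branch:
  assumes "t \<in> T" shows "under r t \<in> branches T r"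
  using assms le_refl le_in le_trans below_comparable
  unfolding branches_def total_on_def direct_pred_def under_def underS_def by blast

lemma finite_branch:
  assumes b: "b \<in> branches T r" "finite b"
  obtains t where "t \<in> b" "b = under r t"
proof -
  have "total_on b r" using b by (simp add: branches_def)
  then have "\<exists>m\<in>b. \<forall>a\<in>b. (a, m) \<in> r"
    by (rule finite_chain_greatest[OF b(2) branchD(1)[OF b(1)] _ trans_r])
      (use branchD(2)[OF b(1)] le_refl in auto)
  then obtain m where m: "m \<in> b" "\<forall>a\<in>b. (a, m) \<in> r" by blast
  then have "b = under r m" using branch_downward[OF b(1) m(1)] by (auto simp: under_def)
  then show ?thesis using m that by blast
qed

lemma in_U: "b \<in> U t \<longleftrightarrow> b \<in> branches T r \<and> t \<in> b"
  by (simp add: tree_nbhd_def)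

lemma U_mono: "(s, t) \<in> r \<Longrightarrow> U t \<subseteq> U s"
  unfolding in_U subset_iff using branch_downward by blast

lemma under_in_U: "t \<in> T \<Longrightarrow> under r t \<in> U t"
  using under_branch le_refl by (auto simp: in_U under_def)

lemma openin_U: "t \<in> T \<Longrightarrow> openin K (U t)"
  unfolding tree_topology_def openin_topology_generated_by_iff
  by (rule generate_topology_on.Basis) auto

lemma closedin_U: "t \<in> T \<Longrightarrow> closedin K (U t)"
  unfolding closedin_def topspace_tree_topology
  by (auto simp: in_U) (auto simp: tree_topology_def openin_topology_generated_by_iff intro!: generate_topology_on.Basis)

lemma openin_basic: "t \<in> T \<Longrightarrow> finite E \<Longrightarrow> E \<subseteq> T \<Longrightarrow> openin K (basic t E)"
  unfolding basic_def by (intro openin_diff openin_U closedin_Union) (auto intro: closedin_U)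

lemma closedin_basic: "t \<in> T \<Longrightarrow> E \<subseteq> T \<Longrightarrow> closedin K (basic t E)"
  unfolding basic_def by (intro closedin_diff closedin_U openin_Union) (auto intro: openin_U)

section \<open>Neighbourhood bases, compactness and separation\<close>

lemma openin_tree_basic:
  assumes "openin K V" "b \<in> V"
  shows "\<exists>t E. t \<in> b \<and> finite E \<and> E \<subseteq> T \<and> E \<inter> b = {} \<and> basic t E \<subseteq> V"
proof -
  have b: "b \<in> branches T r"
    using openin_subset[OF assms(1)] assms(2) by (auto simp: topspace_tree_topology)
  have "generate_topology_on (U ` T \<union> (\<lambda>t. branches T r - U t) ` T) V"
    using assms(1) by (simp add: tree_topology_def openin_topology_generated_by_iff)
  then show ?thesis using assms(2)
  proof (induction V)
    case (Int V W)
    obtain t1 E1 where 1: "t1 \<in> b" "finite E1" "E1 \<subseteq> T" "E1 \<inter> b = {}" "basic t1 E1 \<subseteq> V"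
      using Int.IH(1) Int.prems by auto
    obtain t2 E2 where 2: "t2 \<in> b" "finite E2" "E2 \<subseteq> T" "E2 \<inter> b = {}" "basic t2 E2 \<subseteq> W"
      using Int.IH(2) Int.prems by auto
    \<comment> \<open>Two nodes of a branch are comparable, and the larger one serves both
      neighbourhoods.\<close>
    have "\<exists>t\<in>b. (t1, t) \<in> r \<and> (t2, t) \<in> r"
      using branchD(3)[OF b 1(1) 2(1)] 1(1) 2(1) le_refl[of t1] le_refl[of t2] branchD(2)[OF b]
      by (metis subsetD)
    then obtain t where t: "t \<in> b" "(t1, t) \<in> r" "(t2, t) \<in> r" by blast
    have "basic t (E1 \<union> E2) \<subseteq> V \<inter> W"
      using 1(5) 2(5) U_mono[OF t(2)] U_mono[OF t(3)] unfolding basic_def by blast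
    then show ?case using t 1 2 by (intro exI[of _ t] exI[of _ "E1 \<union> E2"]) auto
  next
    case (UN \<V>)
    then obtain V where V: "V \<in> \<V>" "b \<in> V" by blast
    then show ?case using UN.IH[OF V] by blast
  next
    case (Basis V)
    then consider t where "t \<in> T" "V = U t" | t where "t \<in> T" "V = branches T r - U t" by blast
    then show ?case
    proof cases
      case 1
      then show ?thesis using Basis.prems by (intro exI[of _ t] exI[of _ "{}"]) (auto simp: basic_def in_U)
    next
      case 2
      then have "t \<notin> b" using Basis.prems by (auto simp: in_U)
      obtain t' where "t' \<in> b" using branchD(1)[OF b] by blast
      then show ?thesis using 2 \<open>t \<notin> b\<close>
        by (intro exI[of _ t'] exI[of _ "{t}"]) (auto simp: basic_def in_U)
    qed
  qed simp
qed

text \<open>Around the branch of a node \<open>t\<close> it is enough to exclude finitely many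
  children of \<open>t\<close>. An excluded node above \<open>t\<close> is handled by the child
  below it, and an excluded node not above \<open>t\<close> lies on no branch through
  \<open>t\<close>.\<close>

lemma nbhd_node:
  assumes V: "openin K V" "under r t \<in> V" and t: "t \<in> T"
  shows "\<exists>E. finite E \<and> (\<forall>s\<in>E. direct_pred r t s) \<and> basic t E \<subseteq> V"
proof -
  obtain t' E where E: "t' \<in> under r t" "finite E" "E \<subseteq> T" "E \<inter> under r t = {}" "basic t' E \<subseteq> V"
    using openin_tree_basic[OF V] by blast
  define c where "c e = (SOME c. direct_pred r t c \<and> (c, e) \<in> r)" for e
  have c: "direct_pred r t (c e) \<and> (c e, e) \<in> r" if "e \<in> E" "(t, e) \<in> r" for e
  proof -
    have "t \<noteq> e" using that E(4) le_refl[OF t] by (auto simp: under_def)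
    then show ?thesis unfolding c_def
      using child_exists[OF that(2)] by (metis (mono_tags, lifting) someI_ex)
  qed
  let ?E = "c ` {e\<in>E. (t, e) \<in> r}"
  have "basic t ?E \<subseteq> basic t' E"
  proof
    fix b assume b: "b \<in> basic t ?E"
    then have br: "b \<in> branches T r" "t \<in> b" by (auto simp: basic_def in_U)
    have "b \<notin> U e" if e: "e \<in> E" for e
    proof
      assume "b \<in> U e"
      then have "(e, t) \<in> r \<or> (t, e) \<in> r" "e \<in> b" using branchD(3)[OF br(1), of e t] br by (auto simp: in_U)
      then have te: "(t, e) \<in> r" using e E(4) by (auto simp: under_def)
      then have "b \<in> U (c e)" using c[OF e te] branch_downward[OF br(1) \<open>e \<in> b\<close>] br by (auto simp: in_U)
      then show False using b e te by (auto simp: basic_def)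
    qed
    moreover have "b \<in> U t'" using E(1) br branch_downward[OF br] by (auto simp: in_U under_def)
    ultimately show "b \<in> basic t' E" by (auto simp: basic_def)
  qed
  then show ?thesis using c E by (intro exI[of _ ?E]) auto
qed

lemma infinite_branch_above:
  assumes b: "b \<in> branches T r" "infinite b" and A: "finite A" "A \<subseteq> T"
  shows "\<exists>t\<in>b. \<forall>a\<in>A. (t, a) \<notin> r"
proof -
  have "finite (\<Union>a\<in>A. under r a)" using A finite_under by auto
  then obtain t where "t \<in> b" "t \<notin> (\<Union>a\<in>A. under r a)" using b(2) by (meson finite_subset subsetI)
  then show ?thesis by (auto simp: under_def)
qed

text \<open>An infinite branch eventually leaves the finite set of nodes below the excluded ones.
  From there on, no branch through its current node meets an excluded node.\<close>

lemma nbhd_infinite: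
  assumes V: "openin K V" "b \<in> V" and b: "infinite b"
  shows "\<exists>t\<in>b. U t \<subseteq> V"
proof -
  have br: "b \<in> branches T r" using openin_subset[OF V(1)] V(2) by (auto simp: topspace_tree_topology)
  obtain t' E where E: "t' \<in> b" "finite E" "E \<subseteq> T" "E \<inter> b = {}" "basic t' E \<subseteq> V"
    using openin_tree_basic[OF V] by blast
  moreover have "t' \<in> T" using E(1) branchD(2)[OF br] by blast
  ultimately obtain t where t: "t \<in> b" "\<forall>a\<in>insert t' E. (t, a) \<notin> r"
    using infinite_branch_above[OF br b, of "insert t' E"] by auto
  have "(t', t) \<in> r" using branchD(3)[OF br E(1) t(1)] t(2) by blast
  moreover have "U t \<inter> U e = {}" if "e \<in> E" for e
  proof (rule ccontr)
    assume "\<not> ?thesis"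
    then obtain b' where b': "b' \<in> branches T r" "t \<in> b'" "e \<in> b'" by (auto simp: in_U)
    then have "(e, t) \<in> r" using branchD(3)[OF b'(1), of t e] t(2) that by auto
    then show False using branch_downward[OF br t(1)] E(4) that by auto
  qed
  ultimately have "U t \<subseteq> basic t' E" using U_mono[of t' t] unfolding basic_def by auto
  then show ?thesis using E t by blast
qed

lemma initial_exists:
  assumes "b \<in> branches T r" shows "\<exists>t\<in>initial_nodes T r. t \<in> b"
proof -
  obtain t where t: "t \<in> b" "\<And>s. s \<in> b \<Longrightarrow> card (under r t) \<le> card (under r s)"
    using branchD(1)[OF assms] ex_has_least_nat[of "\<lambda>t. t \<in> b" _ "\<lambda>t. card (under r t)"] by auto
  have "s = t" if "(s, t) \<in> r" for s
  proof (rule ccontr)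
    assume "s \<noteq> t"
    then have "under r s \<subset> under r t" using under_psubset[OF that] by simp
    then have "card (under r s) < card (under r t)"
      using finite_under le_in[OF that] by (intro psubset_card_mono) auto
    then show False using t(2)[of s] branch_downward[OF assms t(1) that] by simp
  qed
  then show ?thesis using t branchD(2)[OF assms] by (auto simp: initial_nodes_def)
qed

text \<open>A Koenig argument. If \<open>U t\<close> has no finite subcover, then neither has
  \<open>U s\<close> for some child \<open>s\<close>, since a cover member around the branch of
  \<open>t\<close> misses parts of only finitely many of them. The infinite branch so produced has a
  neighbourhood \<open>U (f n)\<close> inside one cover member.\<close>

lemma compact_space_tree:
  assumes fin: "finite (initial_nodes T r)"
  shows "compact_space K"
  unfolding compact_space_def compactin_def
proof (intro conjI allI impI)
  fix \<V> assume \<V>: "Ball \<V> (openin K) \<and> topspace K \<subseteq> \<Union> \<V>"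
  define bad where "bad A = (\<nexists>\<F>. finite \<F> \<and> \<F> \<subseteq> \<V> \<and> A \<subseteq> \<Union> \<F>)" for A
  have bad_union: "\<exists>a\<in>I. bad (G a)" if "bad A" "A \<subseteq> (\<Union>a\<in>I. G a)" "finite I" for A I and G :: "'t \<Rightarrow> 't set set"
  proof (rule ccontr)
    assume "\<not> ?thesis"
    then have "\<forall>a\<in>I. \<exists>\<F>. finite \<F> \<and> \<F> \<subseteq> \<V> \<and> G a \<subseteq> \<Union> \<F>" unfolding bad_def by blast
    from bchoice[OF this] obtain \<F> where \<F>: "\<forall>a\<in>I. finite (\<F> a) \<and> \<F> a \<subseteq> \<V> \<and> G a \<subseteq> \<Union> (\<F> a)" ..
    have "A \<subseteq> \<Union> (\<Union>a\<in>I. \<F> a)"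
    proof
      fix x assume "x \<in> A"
      then obtain a where "a \<in> I" "x \<in> G a" using \<open>A \<subseteq> (\<Union>a\<in>I. G a)\<close> by auto
      then have "x \<in> \<Union> (\<F> a)" using \<F> by blast
      then show "x \<in> \<Union> (\<Union>a\<in>I. \<F> a)" using \<open>a \<in> I\<close> by blast
    qed
    moreover have "finite (\<Union>a\<in>I. \<F> a)" "(\<Union>a\<in>I. \<F> a) \<subseteq> \<V>" using \<F> \<open>finite I\<close> by auto
    ultimately have "finite (\<Union>a\<in>I. \<F> a) \<and> (\<Union>a\<in>I. \<F> a) \<subseteq> \<V> \<and> A \<subseteq> \<Union> (\<Union>a\<in>I. \<F> a)" by simp
    then show False using that(1) unfolding bad_def by blast
  qed
  show "\<exists>\<F>. finite \<F> \<and> \<F> \<subseteq> \<V> \<and> topspace K \<subseteq> \<Union> \<F>"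
  proof (rule ccontr)
    assume "\<not> ?thesis"
    then have "bad (branches T r)" by (simp add: bad_def topspace_tree_topology)
    moreover have "branches T r \<subseteq> (\<Union>t\<in>initial_nodes T r. U t)" using initial_exists by (auto simp: in_U)
    ultimately obtain t0 where t0: "t0 \<in> initial_nodes T r" "bad (U t0)"
      using bad_union[OF _ _ fin] by blast
    have step: "\<exists>s. direct_pred r t s \<and> bad (U s)" if t: "t \<in> T" "bad (U t)" for t
    proof -
      obtain V where V: "V \<in> \<V>" "under r t \<in> V"
        using \<V> under_branch[OF t(1)] by (auto simp: topspace_tree_topology)
      then obtain E where E: "finite E" "\<forall>s\<in>E. direct_pred r t s" "basic t E \<subseteq> V"
        using nbhd_node[of V t] \<V> t(1) by blast
      have "bad (U t - V)"
      proof (rule ccontr)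
        assume "\<not> bad (U t - V)"
        then obtain \<F> where "finite \<F>" "\<F> \<subseteq> \<V>" "U t - V \<subseteq> \<Union> \<F>" by (auto simp: bad_def)
        then have "finite (insert V \<F>) \<and> insert V \<F> \<subseteq> \<V> \<and> U t \<subseteq> \<Union> (insert V \<F>)" using V by auto
        then show False using t(2) unfolding bad_def by blast
      qed
      then show ?thesis using bad_union[of "U t - V" U E] E by (auto simp: basic_def)
    qed
    \<comment> \<open>The clause for \<open>n = 0\<close> pins the start to an initial node;
      otherwise the range of \<open>f\<close> might not be closed under direct predecessors.\<close>
    have "\<exists>f. \<forall>n. (f n \<in> T \<and> bad (U (f n)) \<and> (n = 0 \<longrightarrow> f n = t0)) \<and> direct_pred r (f n) (f (Suc n))"
    proof (rule dependent_nat_choice)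
      show "\<exists>x. x \<in> T \<and> bad (U x) \<and> ((0::nat) = 0 \<longrightarrow> x = t0)" using t0 by (auto simp: initial_nodes_def)
      fix x and n :: nat assume "x \<in> T \<and> bad (U x) \<and> (n = 0 \<longrightarrow> x = t0)"
      then obtain s where "direct_pred r x s" "bad (U s)" using step[of x] by auto
      then show "\<exists>y. (y \<in> T \<and> bad (U y) \<and> (Suc n = 0 \<longrightarrow> y = t0)) \<and> direct_pred r x y"
        using le_in by (auto simp: direct_pred_def underS_def)
    qed
    then obtain f where f: "\<And>n. f n \<in> T" "\<And>n. bad (U (f n))" "f 0 = t0"
      "\<And>n. direct_pred r (f n) (f (Suc n))" by metis
    have f1: "(f n, f (Suc n)) \<in> r" "f n \<noteq> f (Suc n)" for n using f(4)[of n] by (auto simp: direct_pred_def underS_def)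
    have mono: "(f m, f n) \<in> r" if "m \<le> n" for m n
      using that by (induction rule: dec_induct) (use f(1) le_refl f1(1) le_trans in blast)+
    have "f m \<noteq> f n" if "m < n" for m n
      using mono[of "Suc m" n] that f1[of m] le_antisym[of "f m" "f (Suc m)"] by auto
    then have "inj f" by (metis injI linorder_less_linear)
    then have inf: "infinite (range f)" using finite_imageD by blast
    have "range f \<in> branches T r"
    proof -
      have "s \<in> range f" if s: "direct_pred r s (f n)" for s n
      proof (cases n)
        case 0
        then have "s = t0" using s f(3) t0(1) le_in unfolding initial_nodes_def direct_pred_def underS_def by blast
        then show ?thesis using f(3) by auto
      next
        case (Suc m)
        have "(s, f m) \<in> r" "(f m, s) \<in> r" using s f(4)[of m] Suc by (auto simp: direct_pred_def)
        then show ?thesis using le_antisym by blast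
      qed
      moreover have "(f m, f n) \<in> r \<or> (f n, f m) \<in> r" for m n using mono by (meson nat_le_linear)
      ultimately show ?thesis unfolding branches_def total_on_def using f(1) by auto
    qed
    then obtain V where V: "V \<in> \<V>" "range f \<in> V" using \<V> by (auto simp: topspace_tree_topology)
    then obtain n where "U (f n) \<subseteq> V" using nbhd_infinite[OF _ V(2) inf] \<V> by blast
    then have "finite {V} \<and> {V} \<subseteq> \<V> \<and> U (f n) \<subseteq> \<Union> {V}" using V by simp
    then show False using f(2)[of n] unfolding bad_def by blast
  qed
qed simp

lemma Hausdorff_space_tree: "Hausdorff_space K"
  unfolding Hausdorff_space_def
proof (intro allI impI)
  fix b b' assume b: "b \<in> topspace K \<and> b' \<in> topspace K \<and> b \<noteq> b'"
  have sep: "\<exists>V W. openin K V \<and> openin K W \<and> b \<in> V \<and> b' \<in> W \<and> disjnt V W"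
    if "t \<in> b" "t \<notin> b'" "b \<in> branches T r" "b' \<in> branches T r" for t b b'
  proof (intro exI conjI)
    have t: "t \<in> T" using that branchD(2) by blast
    show "openin K (U t)" "openin K (topspace K - U t)" using openin_U[OF t] closedin_U[OF t] by auto
  qed (use that in \<open>auto simp: in_U topspace_tree_topology disjnt_def\<close>)
  consider t where "t \<in> b" "t \<notin> b'" | t where "t \<in> b'" "t \<notin> b" using b by blast
  then show "\<exists>V W. openin K V \<and> openin K W \<and> b \<in> V \<and> b' \<in> W \<and> disjnt V W"
  proof cases
    case 1
    then show ?thesis using sep[of t b b'] b by (simp add: topspace_tree_topology)
  next
    case 2
    then show ?thesis using sep[of t b' b] b by (metis disjnt_sym topspace_tree_topology)
  qed
qed

end

section \<open>Counting basic sets and partitioning open sets into them\<close>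

context tree_space
begin

definition basics :: "'t set set set" where
  "basics = {basic t E | t E. t \<in> T \<and> finite E \<and> E \<subseteq> T}"

lemma basicsI: "t \<in> T \<Longrightarrow> finite E \<Longrightarrow> E \<subseteq> T \<Longrightarrow> basic t E \<in> basics"
  by (auto simp: basics_def)

lemma basics_clopen: "C \<in> basics \<Longrightarrow> openin K C" "C \<in> basics \<Longrightarrow> closedin K C"
  by (auto simp: basics_def intro: openin_basic closedin_basic)

text \<open>This bounds the number of clopen sets available as nodes of the new tree. Sets with
  \<open>n\<close> exclusions are images of sets with one fewer exclusion paired with a node, so no
  stage exceeds the infinite cardinal of \<open>T\<close>, nor does their countable union.\<close>

lemma card_basics:
  assumes "infinite T"
  shows "card_of basics \<le>o card_of T"
proof -
  define B where "B = rec_nat (U ` T) (\<lambda>_ \<V>. (\<lambda>(V, s). V - U s) ` (\<V> \<times> T))"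
  have B: "B 0 = U ` T" "B (Suc n) = (\<lambda>(V, s). V - U s) ` (B n \<times> T)" for n
    by (auto simp: B_def)
  have "card_of (B n) \<le>o card_of T" for n
  proof (induction n)
    case 0
    show ?case unfolding B by (rule card_of_image)
  next
    case (Suc n)
    have "card_of (B n \<times> T) \<le>o card_of T"
      by (rule card_of_Sigma_ordLeq_infinite[OF assms Suc]) (simp add: ordLeq_reflexive card_of_Well_order)
    then show ?case unfolding B using card_of_image ordLeq_transitive by blast
  qed
  then have "card_of (\<Union>n\<in>UNIV. B n) \<le>o card_of T"
    using card_of_UNION_ordLeq_infinite[OF assms, of "UNIV :: nat set"] assms infinite_iff_card_of_nat by blast
  moreover have "basics \<subseteq> (\<Union>n\<in>UNIV. B n)"
  proof
    fix C assume "C \<in> basics"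
    then obtain t E where C: "C = basic t E" "t \<in> T" "finite E" "E \<subseteq> T" by (auto simp: basics_def)
    have "\<exists>n. basic t E \<in> B n" using C(3,4)
    proof (induction E)
      case empty
      show ?case using C(2) by (intro exI[of _ 0]) (simp add: B basic_def)
    next
      case (insert s E)
      then obtain n where "basic t E \<in> B n" by blast
      moreover have "basic t (insert s E) = basic t E - U s" by (auto simp: basic_def)
      ultimately have "basic t (insert s E) \<in> B (Suc n)" using insert.prems by (auto simp: B intro!: image_eqI[of _ _ "(basic t E, s)"])
      then show ?case by blast
    qed
    then show "C \<in> (\<Union>n\<in>UNIV. B n)" using C by blast
  qed
  ultimately show ?thesis using card_of_mono1 ordLeq_transitive by blast
qed

lemma child_eq:
  assumes "direct_pred r p s" "direct_pred r p s'" "(s, s') \<in> r \<or> (s', s) \<in> r"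
  shows "s = s'"
  using assms le_antisym unfolding direct_pred_def underS_def by blast

text \<open>The partition consists of one set around each branch \<open>under r t\<close> in \<open>V\<close> with \<open>t\<close> in a subtree \<open>ST\<close>,
  namely \<open>U t\<close> without the finitely many \<open>U s\<close>, \<open>s \<in> E t\<close>. The subtree contains only the children in
  \<open>E t\<close> of such a \<open>t\<close>, and all children of the other nodes. An infinite branch of \<open>V\<close> leaves it, because
  some \<open>U t\<close> around it is good, and then \<open>E t\<close> is empty.\<close>

lemma tree_partition:
  assumes V: "openin K V"
    and good: "\<And>b. b \<in> V \<Longrightarrow> \<exists>N. openin K N \<and> b \<in> N \<and> (\<forall>C\<in>basics. b \<in> C \<and> C \<subseteq> N \<longrightarrow> good C)"
  shows "\<exists>P. pairwise disjnt P \<and> \<Union> P = V \<and> (\<forall>C\<in>P. C \<noteq> {} \<and> good C \<and> C \<in> basics)"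
proof -
  have "\<exists>N. openin K N \<and> b \<in> N \<and> N \<subseteq> V \<and> (\<forall>C\<in>basics. b \<in> C \<and> C \<subseteq> N \<longrightarrow> good C)" if b: "b \<in> V" for b
  proof -
    obtain N where "openin K N" "b \<in> N" "\<forall>C\<in>basics. b \<in> C \<and> C \<subseteq> N \<longrightarrow> good C" using good[OF b] by blast
    \<comment> \<open>Shrinking \<open>N\<close> keeps the property, which speaks only about basic
      sets inside \<open>N\<close>.\<close>
    then show ?thesis using V b by (intro exI[of _ "N \<inter> V"]) auto
  qed
  then obtain N where N: "\<And>b. b \<in> V \<Longrightarrow> openin K (N b)" "\<And>b. b \<in> V \<Longrightarrow> b \<in> N b" "\<And>b. b \<in> V \<Longrightarrow> N b \<subseteq> V"
    "\<And>b C. b \<in> V \<Longrightarrow> C \<in> basics \<Longrightarrow> b \<in> C \<Longrightarrow> C \<subseteq> N b \<Longrightarrow> good C"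
    by metis
  have brV: "b \<in> branches T r" if "b \<in> V" for b
    using openin_subset[OF V] that by (auto simp: topspace_tree_topology)
  have U_basic: "U t = basic t {}" for t by (simp add: basic_def)
  let ?good = "\<lambda>C. C \<subseteq> V \<and> good C"
  have ex: "\<exists>E. finite E \<and> (\<forall>s\<in>E. direct_pred r t s) \<and> ?good (basic t E) \<and> (?good (U t) \<longrightarrow> E = {})"
    if t: "t \<in> T" "under r t \<in> V" for t
  proof (cases "?good (U t)")
    case True
    then show ?thesis unfolding U_basic by (intro exI[of _ "{}"]) auto
  next
    case False
    obtain E where E: "finite E" "\<forall>s\<in>E. direct_pred r t s" "basic t E \<subseteq> N (under r t)"
      using nbhd_node[OF N(1,2)[OF t(2)] t(1)] by blast
    have "E \<subseteq> T" using E(2) le_in by (auto simp: direct_pred_def underS_def)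
    moreover have "under r t \<in> basic t E"
      using under_in_U[OF t(1)] E(2) le_antisym by (auto simp: basic_def in_U under_def direct_pred_def underS_def)
    ultimately have "?good (basic t E)"
      using N(3)[OF t(2)] N(4)[OF t(2) basicsI[OF t(1) E(1)]] E(3) by auto
    then show ?thesis using E(1,2) False by blast
  qed
  define E where "E t = (SOME E. finite E \<and> (\<forall>s\<in>E. direct_pred r t s) \<and> ?good (basic t E) \<and> (?good (U t) \<longrightarrow> E = {}))" for t
  have E: "finite (E t)" "\<And>s. s \<in> E t \<Longrightarrow> direct_pred r t s" "basic t (E t) \<subseteq> V" "good (basic t (E t))"
    "?good (U t) \<Longrightarrow> E t = {}" if "t \<in> T" "under r t \<in> V" for t
    using someI_ex[OF ex[OF that]] unfolding E_def[symmetric] by auto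
  define ST where "ST = {t\<in>T. \<forall>p s. s \<in> under r t \<and> direct_pred r p s \<and> under r p \<in> V \<longrightarrow> s \<in> E p}"
  define I where "I = {t\<in>ST. under r t \<in> V}"
  define P where "P = (\<lambda>t. basic t (E t)) ` I"
  have I: "t \<in> T" "under r t \<in> V" if "t \<in> I" for t using that by (auto simp: I_def ST_def)
  have disj1: "basic t (E t) \<inter> basic t' (E t') = {}" if tt: "t \<in> I" "t' \<in> I" "(t, t') \<in> r" "t \<noteq> t'" for t t'
  proof (rule ccontr)
    assume "\<not> ?thesis"
    then obtain b where "b \<in> basic t (E t)" "b \<in> basic t' (E t')" by blast
    then have b: "b \<in> basic t (E t)" "b \<in> branches T r" "t' \<in> b" by (auto simp: basic_def in_U)
    \<comment> \<open>\<open>c\<close> is the child of \<open>t\<close> towards \<open>t'\<close>.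
      As \<open>t'\<close> lies in \<open>ST\<close>, this child is in \<open>E t\<close>, so
      everything through \<open>t'\<close> was removed from the piece at \<open>t\<close>.\<close>
    obtain c where c: "direct_pred r t c" "(c, t') \<in> r" using child_exists[OF tt(3,4)] by blast
    then have "c \<in> E t" using tt(1,2) unfolding I_def ST_def under_def by blast
    moreover have "b \<in> U c" using branch_downward[OF b(2,3) c(2)] b(2) by (simp add: in_U)
    ultimately show False using b(1) by (auto simp: basic_def)
  qed
  have disj: "basic t (E t) \<inter> basic t' (E t') = {}" if "t \<in> I" "t' \<in> I" "t \<noteq> t'" for t t'
  proof (cases "(t, t') \<in> r \<or> (t', t) \<in> r")
    case True
    then show ?thesis using disj1[of t t'] disj1[of t' t] that by blast
  next
    case False
    then have "U t \<inter> U t' = {}" unfolding disjoint_iff in_U using branchD(3) by blast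
    then show ?thesis by (auto simp: basic_def)
  qed
  then have "pairwise disjnt P"
    unfolding P_def pairwise_def disjnt_def by blast
  moreover have "C \<noteq> {} \<and> good C \<and> C \<in> basics" if "C \<in> P" for C
  proof -
    obtain t where t: "t \<in> I" "C = basic t (E t)" using \<open>C \<in> P\<close> by (auto simp: P_def)
    note Et = E[OF I[OF t(1)]]
    have "E t \<subseteq> T" using Et(2) le_in by (auto simp: direct_pred_def underS_def)
    moreover have "under r t \<in> basic t (E t)"
      using under_in_U[OF I(1)[OF t(1)]] Et(2) le_antisym
      by (auto simp: basic_def in_U under_def direct_pred_def underS_def)
    ultimately show ?thesis using t Et I by (auto intro: basicsI)
  qed
  moreover have "\<Union> P \<subseteq> V" using E(3) I by (auto simp: P_def)
  moreover have "V \<subseteq> \<Union> P"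
  proof
    fix b assume b: "b \<in> V"
    note br = brV[OF b]
    show "b \<in> \<Union> P"
    proof (cases "b \<subseteq> ST")
      case True
      have "finite b"
      proof (rule ccontr)
        assume inf: "infinite b"
        obtain t where t: "t \<in> b" "U t \<subseteq> N b" using nbhd_infinite[OF N(1,2)[OF b] inf] by blast
        have tT: "t \<in> T" using t(1) branchD(2)[OF br] by blast
        have "U t \<in> basics" unfolding U_basic by (rule basicsI[OF tT]) auto
        then have g: "?good (U t)" using N(3)[OF b] N(4)[OF b _ _ t(2)] t br by (auto simp: in_U)
        then have V': "under r t \<in> V" using under_in_U[OF tT] by blast
        obtain e where e: "e \<in> b" "(e, t) \<notin> r"
          using infinite_branch_above[OF br inf, of "{t}"] tT by auto
        then have "(t, e) \<in> r" "t \<noteq> e" using branchD(3)[OF br t(1) e(1)] le_refl[OF tT] by auto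
        then obtain c where c: "direct_pred r t c" "(c, e) \<in> r" using child_exists by blast
        then have "c \<in> ST" using branch_downward[OF br e(1) c(2)] True by blast
        then have "c \<in> E t" using c(1) V' le_refl[of c] unfolding ST_def under_def by blast
        then show False using E(5)[OF tT V' g] by simp
      qed
      then obtain t where t: "t \<in> b" "b = under r t" using finite_branch[OF br] by blast
      then have tI: "t \<in> I" using True b by (auto simp: I_def)
      have "b \<in> basic t (E t)"
        using under_in_U[OF I(1)[OF tI]] t(2) E(2)[OF I[OF tI]] le_antisym
        by (auto simp: basic_def in_U under_def direct_pred_def underS_def)
      then show ?thesis using tI by (auto simp: P_def)
    next
      case False
      then obtain s0 where "s0 \<in> b - ST" by blast
      \<comment> \<open>At the first node \<open>s\<close> outside \<open>ST\<close>, the parent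
        \<open>p\<close> owns a piece and \<open>s\<close> is not in \<open>E p\<close>. The branch
        contains no other child of \<open>p\<close>, hence it lies in the piece at
        \<open>p\<close>.\<close>
      then obtain s where s: "s \<in> b" "s \<notin> ST" "\<And>s'. s' \<in> b \<Longrightarrow> s' \<notin> ST \<Longrightarrow> card (under r s) \<le> card (under r s')"
        using ex_has_least_nat[of "\<lambda>s. s \<in> b - ST" s0 "\<lambda>s. card (under r s)"] by blast
      have small: "s' \<in> ST" if "(s', s) \<in> r" "s' \<noteq> s" for s'
      proof (rule ccontr)
        assume "s' \<notin> ST"
        then have "card (under r s) \<le> card (under r s')" using s(3) branch_downward[OF br s(1) that(1)] by blast
        moreover have "card (under r s') < card (under r s)"
          using under_psubset[OF that] finite_under le_in[OF that(1)] by (intro psubset_card_mono) auto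
        ultimately show False by simp
      qed
      have sT: "s \<in> T" using s(1) branchD(2)[OF br] by blast
      obtain p s' where ps: "(s', s) \<in> r" "direct_pred r p s'" "under r p \<in> V" "s' \<notin> E p"
        using s(2) sT by (auto simp: ST_def under_def)
      have "s' \<notin> ST" using ps le_refl[of s'] le_in[OF ps(1)] unfolding ST_def under_def by blast
      then have "s' = s" using small ps(1) by blast
      then have p: "(p, s) \<in> r" "p \<noteq> s" using ps(2) by (auto simp: direct_pred_def underS_def)
      then have pI: "p \<in> I" using small ps(3) by (auto simp: I_def)
      have "e \<notin> b" if e: "e \<in> E p" for e
      proof
        assume "e \<in> b"
        then have "e = s" using child_eq[OF E(2)[OF I[OF pI] e], of s] branchD(3)[OF br _ s(1)] ps(2) \<open>s' = s\<close> by blast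
        then show False using e ps(4) \<open>s' = s\<close> by blast
      qed
      moreover have "p \<in> b" using branch_downward[OF br s(1) p(1)] .
      ultimately have "b \<in> basic p (E p)" using br by (auto simp: basic_def in_U)
      then show ?thesis using pI by (auto simp: P_def)
    qed
  qed
  ultimately show ?thesis by blast
qed

end

section \<open>Spaces of continuous functions and quotient maps\<close>

lemma mspace_C_space:
  assumes "compact_space K"
  shows "f \<in> mspace (C_space K) \<longleftrightarrow> f \<in> extensional (topspace K) \<and> continuous_map K euclidean f"
  unfolding compactin_mspace_cfunspace[OF assms[unfolded compact_space_def], of euclidean_metric] by simp

lemma mdist_C_space_upper:
  assumes "f \<in> mspace (C_space K)" "g \<in> mspace (C_space K)" "x \<in> topspace K"
  shows "\<bar>f x - g x\<bar> \<le> mdist (C_space K) f g"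
  using mdist_cfunspace_imp_mdist_le[OF assms(1,2) order_refl assms(3)] by (simp add: dist_real_def)

lemma C_space_closed:
  assumes K: "compact_space K"
  shows "C_zero K \<in> mspace (C_space K)"
    and "f \<in> mspace (C_space K) \<Longrightarrow> g \<in> mspace (C_space K) \<Longrightarrow> C_add K f g \<in> mspace (C_space K)"
    and "f \<in> mspace (C_space K) \<Longrightarrow> C_scale K c f \<in> mspace (C_space K)"
proof -
  have r: "continuous_map K euclidean (restrict h (topspace K)) \<longleftrightarrow> continuous_map K euclidean h" for h :: "'a \<Rightarrow> real"
    by (auto intro: continuous_map_eq)
  show "C_zero K \<in> mspace (C_space K)"
    unfolding mspace_C_space[OF K] C_zero_def r by simp
  show "C_add K f g \<in> mspace (C_space K)" if "f \<in> mspace (C_space K)" "g \<in> mspace (C_space K)"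
    using that unfolding mspace_C_space[OF K] C_add_def r by (auto intro: continuous_map_add)
  show "C_scale K c f \<in> mspace (C_space K)" if "f \<in> mspace (C_space K)"
    using that unfolding mspace_C_space[OF K] C_scale_def r by (auto intro: continuous_map_real_mult_left)
qed

text \<open>Pulling back along a surjection keeps the set of values of a difference and hence the
  supremum distance. The isomorphism from \<open>Y\<close> is the inverse of the pull-back.\<close>

lemma C_space_quotient:
  fixes K :: "'k topology" and L :: "'l topology" and \<rho> :: "'k \<Rightarrow> 'l"
  assumes K: "compact_space K" and L: "compact_space L"
    and cont: "continuous_map K L \<rho>" and surj: "\<rho> ` topspace K = topspace L"
  defines "\<psi> \<equiv> (\<lambda>f::'l \<Rightarrow> real. \<lambda>x\<in>topspace K. f (\<rho> x))"
  shows "subspace_C (\<psi> ` mspace (C_space L)) K"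
    and "isometrically_isomorphic_C (\<psi> ` mspace (C_space L)) K L"
proof -
  let ?M = "mspace (C_space L)"
  have \<rho>: "\<rho> x \<in> topspace L" if "x \<in> topspace K" for x using surj that by blast
  have \<psi>M: "\<psi> f \<in> mspace (C_space K)" if "f \<in> ?M" for f
  proof -
    have "continuous_map K euclidean (f \<circ> \<rho>)"
      using that cont continuous_map_compose unfolding mspace_C_space[OF L] by blast
    then have "continuous_map K euclidean (\<psi> f)"
      by (rule continuous_map_eq) (simp add: \<psi>_def)
    then show ?thesis unfolding mspace_C_space[OF K] by (simp add: \<psi>_def)
  qed
  have add: "\<psi> (C_add L f g) = C_add K (\<psi> f) (\<psi> g)" and scale: "\<psi> (C_scale L c f) = C_scale K c (\<psi> f)"
    and zero: "\<psi> (C_zero L) = C_zero K" for f g c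
    using \<rho> by (auto simp: \<psi>_def C_add_def C_scale_def C_zero_def fun_eq_iff)
  show "subspace_C (\<psi> ` ?M) K"
    unfolding subspace_C_def
  proof (intro conjI ballI allI)
    show "\<psi> ` ?M \<subseteq> mspace (C_space K)" using \<psi>M by blast
    show "C_zero K \<in> \<psi> ` ?M" unfolding zero[symmetric] by (intro imageI C_space_closed L)
    fix f assume "f \<in> \<psi> ` ?M"
    then obtain u where u: "f = \<psi> u" "u \<in> ?M" by blast
    show "C_scale K c f \<in> \<psi> ` ?M" for c
      unfolding u scale[symmetric] by (intro imageI C_space_closed L u)
    fix g assume "g \<in> \<psi> ` ?M"
    then obtain v where v: "g = \<psi> v" "v \<in> ?M" by blast
    show "C_add K f g \<in> \<psi> ` ?M"
      unfolding u v add[symmetric] by (intro imageI C_space_closed L u v)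
  qed
  have inj: "inj_on \<psi> ?M"
  proof (rule inj_onI)
    fix u v assume u: "u \<in> ?M" and v: "v \<in> ?M" and eq: "\<psi> u = \<psi> v"
    show "u = v"
    proof (rule extensionalityI[of _ "topspace L"])
      show "u \<in> extensional (topspace L)" "v \<in> extensional (topspace L)"
        using u v unfolding mspace_C_space[OF L] by auto
      fix y assume "y \<in> topspace L"
      then obtain x where "x \<in> topspace K" "y = \<rho> x" using surj by blast
      then show "u y = v y" using fun_cong[OF eq, of x] by (simp add: \<psi>_def)
    qed
  qed
  have dist: "mdist (C_space K) (\<psi> u) (\<psi> v) = mdist (C_space L) u v" if u: "u \<in> ?M" and v: "v \<in> ?M" for u v
  \<comment> \<open>The characterisation of the distance by upper bounds requires a point; over
    empty spaces both distances are zero.\<close>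
  proof (cases "topspace K = {}")
    case True
    then have "topspace L = {}" using surj by simp
    then show ?thesis using True
      by (simp add: mdist_cfunspace_eq_mdist_funspace Metric_space.fdist_empty)
  next
    case False
    then have ne: "topspace L \<noteq> {}" using surj by blast
    have "mdist (C_space K) (\<psi> u) (\<psi> v) \<le> a \<longleftrightarrow> mdist (C_space L) u v \<le> a" for a
    proof -
      have "mdist (C_space K) (\<psi> u) (\<psi> v) \<le> a \<longleftrightarrow> (\<forall>x\<in>topspace K. dist (\<psi> u x) (\<psi> v x) \<le> a)"
        using cfunspace_mdist_le[OF \<psi>M[OF u] \<psi>M[OF v] False] by simp
      also have "\<dots> \<longleftrightarrow> (\<forall>y\<in>\<rho> ` topspace K. dist (u y) (v y) \<le> a)"
        by (simp add: \<psi>_def)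
      also have "\<dots> \<longleftrightarrow> mdist (C_space L) u v \<le> a"
        using cfunspace_mdist_le[OF u v ne] surj by simp
      finally show ?thesis .
    qed
    then show ?thesis by (meson order_antisym order_refl)
  qed
  define \<phi> where "\<phi> = inv_into ?M \<psi>"
  have \<phi>: "\<phi> (\<psi> u) = u" if "u \<in> ?M" for u
    using inj that by (simp add: \<phi>_def)
  have "bij_betw \<phi> (\<psi> ` ?M) ?M"
    unfolding \<phi>_def using inj by (intro bij_betw_inv_into) (simp add: bij_betw_def)
  moreover have "\<phi> (C_add K f g) = C_add L (\<phi> f) (\<phi> g)" if fg: "f \<in> \<psi> ` ?M" "g \<in> \<psi> ` ?M" for f g
  proof -
    obtain u v where uv: "f = \<psi> u" "u \<in> ?M" "g = \<psi> v" "v \<in> ?M" using fg by blast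
    then show ?thesis
      using \<phi>[OF C_space_closed(2)[OF L uv(2,4)]] \<phi>[OF uv(2)] \<phi>[OF uv(4)] by (simp only: add)
  qed
  moreover have "\<phi> (C_scale K c f) = C_scale L c (\<phi> f)" if fg: "f \<in> \<psi> ` ?M" for c f
  proof -
    obtain u where u: "f = \<psi> u" "u \<in> ?M" using fg by blast
    then show ?thesis
      using \<phi>[OF C_space_closed(3)[OF L u(2)], of c] \<phi>[OF u(2)] by (simp only: scale)
  qed
  moreover have "mdist (C_space L) (\<phi> f) (\<phi> g) = mdist (C_space K) f g" if fg: "f \<in> \<psi> ` ?M" "g \<in> \<psi> ` ?M" for f g
  proof -
    obtain u v where uv: "f = \<psi> u" "u \<in> ?M" "g = \<psi> v" "v \<in> ?M" using fg by blast
    show ?thesis using dist[OF uv(2,4)] unfolding uv(1,3) \<phi>[OF uv(2)] \<phi>[OF uv(4)] by simp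
  qed
  ultimately show "isometrically_isomorphic_C (\<psi> ` ?M) K L"
    unfolding isometrically_isomorphic_C_def by blast
qed

text \<open>A closed map pushes a bound on a fibre forward to a neighbourhood in the base. The base
  is then cut into disjoint clopen pieces lying in such neighbourhoods, and the approximant is
  constant on each.\<close>

lemma (in tree_space) locally_constant_approx:
  assumes K: "compact_space X" and \<rho>: "continuous_map X K \<rho>" "\<rho> ` topspace X = topspace K"
    and compact: "finite (initial_nodes T r)"
    and g: "continuous_map X euclidean (g :: 'x \<Rightarrow> real)"
    and osc: "\<And>x y. x \<in> topspace X \<Longrightarrow> y \<in> topspace X \<Longrightarrow> \<rho> x = \<rho> y \<Longrightarrow> \<bar>g x - g y\<bar> < \<delta>"
  shows "\<exists>f\<in>mspace (C_space K). \<forall>x\<in>topspace X. \<bar>g x - f (\<rho> x)\<bar> \<le> \<delta>"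
proof -
  have closed: "closed_map X K \<rho>"
    by (rule continuous_imp_closed_map_gen[OF K _ \<rho>(1)])
      (rule Hausdorff_imp_kc_space[OF Hausdorff_space_tree])
  have "\<exists>N c. openin K N \<and> b \<in> N \<and> (\<forall>x\<in>topspace X. \<rho> x \<in> N \<longrightarrow> \<bar>g x - c\<bar> < \<delta>)" if b: "b \<in> topspace K" for b
  proof -
    have "b \<in> \<rho> ` topspace X" using b \<rho>(2) by simp
    then obtain y where y: "y \<in> topspace X" "\<rho> y = b" by auto
    define V where "V = {x \<in> topspace X. g x \<in> {g y - \<delta><..<g y + \<delta>}}"
    have "openin X V" unfolding V_def using g by (rule openin_continuous_map_preimage) simp
    then have "closedin X (topspace X - V)" by (rule openin_closedin_eq[THEN iffD1, THEN conjunct2])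
    then have "closedin K (\<rho> ` (topspace X - V))" using closed by (simp add: closed_map_def)
    then have "openin K (topspace K - \<rho> ` (topspace X - V))" by (rule openin_diff[OF openin_topspace])
    \<comment> \<open>This is the place where the strict oscillation bound matters: it puts the
      whole fibre over \<open>b\<close> into the open set \<open>V\<close>.\<close>
    moreover have "b \<in> topspace K - \<rho> ` (topspace X - V)"
    proof -
      have "x \<in> V" if "x \<in> topspace X" "\<rho> x = b" for x
        using osc[OF that(1) y(1)] that y by (auto simp: V_def abs_if split: if_splits)
      then show ?thesis using b by auto
    qed
    moreover have "\<forall>x\<in>topspace X. \<rho> x \<in> topspace K - \<rho> ` (topspace X - V) \<longrightarrow> \<bar>g x - g y\<bar> < \<delta>"
      by (auto simp: V_def abs_if)
    ultimately show ?thesis by blast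
  qed
  then obtain N c where N: "\<And>b. b \<in> topspace K \<Longrightarrow> openin K (N b)" "\<And>b. b \<in> topspace K \<Longrightarrow> b \<in> N b"
    "\<And>b x. b \<in> topspace K \<Longrightarrow> x \<in> topspace X \<Longrightarrow> \<rho> x \<in> N b \<Longrightarrow> \<bar>g x - c b\<bar> < \<delta>"
    by metis
  \<comment> \<open>Any condition inherited by subsets is suitable for
    \<open>tree_partition\<close>.\<close>
  let ?good = "\<lambda>C. \<exists>b\<in>topspace K. C \<subseteq> N b"
  have "\<exists>P. pairwise disjnt P \<and> \<Union> P = topspace K \<and> (\<forall>C\<in>P. C \<noteq> {} \<and> ?good C \<and> C \<in> basics)"
    by (rule tree_partition) (use N(1,2) in blast)+
  then obtain P where P: "pairwise disjnt P" "\<Union> P = topspace K" "\<And>C. C \<in> P \<Longrightarrow> ?good C" "P \<subseteq> basics" by blast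
  obtain d where d: "\<And>C. C \<in> P \<Longrightarrow> d C \<in> topspace K \<and> C \<subseteq> N (d C)" using P(3) by metis
  define f where "f = (\<lambda>b\<in>topspace K. c (d (THE C. C \<in> P \<and> b \<in> C)))"
  have f: "f b = c (d C)" if "C \<in> P" "b \<in> C" for b C
  proof -
    have "(THE C. C \<in> P \<and> b \<in> C) = C"
      using that P(1) unfolding pairwise_def disjnt_def by (intro the_equality) blast+
    moreover have "b \<in> topspace K" using P(2) that by blast
    ultimately show ?thesis by (simp add: f_def)
  qed
  have "continuous_map K euclidean f"
    unfolding continuous_map
  proof (intro conjI allI impI)
    fix W :: "real set"
    have "{b \<in> topspace K. f b \<in> W} = \<Union> {C\<in>P. c (d C) \<in> W}"
    proof (rule set_eqI)
      fix b
      have "b \<in> topspace K \<longleftrightarrow> (\<exists>C\<in>P. b \<in> C)" using P(2) by auto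
      then have "b \<in> topspace K \<and> f b \<in> W \<longleftrightarrow> (\<exists>C\<in>P. b \<in> C \<and> c (d C) \<in> W)"
        by (metis f)
      then show "b \<in> {b \<in> topspace K. f b \<in> W} \<longleftrightarrow> b \<in> \<Union> {C\<in>P. c (d C) \<in> W}" by blast
    qed
    moreover have "openin K (\<Union> {C\<in>P. c (d C) \<in> W})"
      using P(4) basics_clopen(1) by (intro openin_Union) blast
    ultimately show "openin K {b \<in> topspace K. f b \<in> W}" by simp
  qed simp
  then have "f \<in> mspace (C_space K)"
    unfolding mspace_C_space[OF compact_space_tree[OF compact]] by (simp add: f_def)
  moreover have "\<bar>g x - f (\<rho> x)\<bar> \<le> \<delta>" if x: "x \<in> topspace X" for x
  proof -
    have \<rho>x: "\<rho> x \<in> topspace K" using imageI[OF x, of \<rho>] \<rho>(2) by simp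
    then have "\<rho> x \<in> \<Union> P" using P(2) by simp
    then obtain C where C: "C \<in> P" "\<rho> x \<in> C" by auto
    then have "\<bar>g x - c (d C)\<bar> < \<delta>" using N(3)[OF _ x, of "d C"] d[OF C(1)] by blast
    then show ?thesis using f[OF C] by simp
  qed
  ultimately show ?thesis by blast
qed

section \<open>Trees of clopen sets\<close>

definition core :: "'s set \<Rightarrow> ('s \<Rightarrow> 'k set) \<Rightarrow> 's \<Rightarrow> 'k set" where
  "core S R s = R s - \<Union> {R t | t. t \<in> S \<and> R t \<subset> R s}"

text \<open>Nodes \<open>s\<close> are kept apart from their sets \<open>R s\<close>: the sets
  consist of branches, while the nodes must be of the node type of the original tree. The rank will
  exclude infinite branches and bound the index.\<close>

locale laminar_family =
  fixes K :: "'k topology" and S :: "'s set" and R :: "'s \<Rightarrow> 'k set" and z :: "'c rel" and rank :: "'s \<Rightarrow> 'c"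
  assumes compact: "compact_space K"
    and clopen: "s \<in> S \<Longrightarrow> openin K (R s)" "s \<in> S \<Longrightarrow> closedin K (R s)"
    and inj: "inj_on R S"
    and covers: "\<Union> (R ` S) = topspace K"
    and laminar: "s \<in> S \<Longrightarrow> t \<in> S \<Longrightarrow> R s \<inter> R t = {} \<or> R s \<subseteq> R t \<or> R t \<subseteq> R s"
    and finite_above: "s \<in> S \<Longrightarrow> finite {t\<in>S. R s \<subseteq> R t}"
    and wo: "Well_order z"
    and rank_Field: "s \<in> S \<Longrightarrow> rank s \<in> Field z"
    and rank_less: "s \<in> S \<Longrightarrow> t \<in> S \<Longrightarrow> R t \<subset> R s \<Longrightarrow> rank t \<in> underS z (rank s)"
    and core_nonempty: "s \<in> S \<Longrightarrow> core S R s \<noteq> {}"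
begin

definition q :: "'s rel" where
  "q = {(s, t). s \<in> S \<and> t \<in> S \<and> R t \<subseteq> R s}"

lemma q_iff: "(s, t) \<in> q \<longleftrightarrow> s \<in> S \<and> t \<in> S \<and> R t \<subseteq> R s"
  by (simp add: q_def)

lemma R_nonempty: "s \<in> S \<Longrightarrow> R s \<noteq> {}"
  using core_nonempty[of s] by (auto simp: core_def)

lemma point_comparable:
  assumes "s \<in> S" "t \<in> S" "x \<in> R s" "x \<in> R t"
  shows "(s, t) \<in> q \<or> (t, s) \<in> q"
  using laminar[OF assms(1,2)] assms by (auto simp: q_iff)

lemma tree_q: "tree S q"
  unfolding tree_def
proof (intro conjI ballI)
  have "refl_on S q" "trans q" by (auto simp: refl_on_def trans_def q_iff)
  moreover have "antisym q" using inj by (auto simp: antisym_def q_iff inj_on_def)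
  moreover have "q \<subseteq> S \<times> S" by (auto simp: q_iff)
  ultimately show "partial_order_on S q" unfolding partial_order_on_def preorder_on_def by blast
  fix t assume t: "t \<in> S"
  show "finite (under q t)"
    by (rule finite_subset[OF _ finite_above[OF t]]) (auto simp: under_def q_iff)
  obtain x where "x \<in> R t" using R_nonempty[OF t] by blast
  then show "total_on (under q t) q"
    using point_comparable[of _ _ x] unfolding total_on_def under_def q_iff by blast
qed

sublocale S: tree_space S q
  by standard (rule tree_q)

lemma point_nodes_branch:
  assumes x: "x \<in> topspace K"
  shows "{s\<in>S. x \<in> R s} \<in> branches S q"
proof -
  have "\<exists>s\<in>S. x \<in> R s" using x covers by blast
  moreover have "total_on {s\<in>S. x \<in> R s} q"
    using point_comparable[of _ _ x] unfolding total_on_def by blast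
  moreover have "s \<in> {s\<in>S. x \<in> R s}" if "direct_pred q s t" "t \<in> {s\<in>S. x \<in> R s}" for s t
    using that by (auto simp: direct_pred_def underS_def q_iff)
  ultimately show ?thesis unfolding branches_def by blast
qed

text \<open>A member of \<open>b\<close> with minimal rank has no member of \<open>b\<close>
  strictly above it in the tree, so all of \<open>b\<close> lies below it.\<close>

lemma finite_branches:
  assumes b: "b \<in> branches S q"
  shows "finite b"
proof -
  obtain s0 where s0: "s0 \<in> b" using S.branchD(1)[OF b] by blast
  have "wf (z - Id)" using wo by (simp add: well_order_on_def)
  then obtain m where m: "m \<in> rank ` b" "\<And>y. (y, m) \<in> z - Id \<Longrightarrow> y \<notin> rank ` b"
    using wfE_min[of "z - Id" "rank s0" "rank ` b"] s0 by blast
  then obtain s where s: "s \<in> b" "m = rank s" by blast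
  have sS: "s \<in> S" using s S.branchD(2)[OF b] by blast
  have "(t, s) \<in> q" if t: "t \<in> b" for t
  proof (rule ccontr)
    assume n: "(t, s) \<notin> q"
    have tS: "t \<in> S" using t S.branchD(2)[OF b] by blast
    have "R t \<subset> R s" using n S.branchD(3)[OF b t s(1)] by (auto simp: q_iff)
    then have "rank t \<in> underS z m" using rank_less[OF sS tS] s by simp
    then show False using m(2)[of "rank t"] t by (auto simp: underS_def)
  qed
  then have "b \<subseteq> under q s" by (auto simp: under_def)
  then show ?thesis using S.finite_under[OF sS] finite_subset by blast
qed

lemma well_founded_q: "well_founded_tree S q"
  using tree_q finite_branches by (auto simp: well_founded_tree_def)

text \<open>The sets of the initial nodes form an open cover of a compact space by non-empty,
  pairwise disjoint sets, so a finite subcover omits none of them.\<close>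

lemma finite_initial: "finite (initial_nodes S q)"
proof -
  let ?I = "initial_nodes S q"
  have IS: "?I \<subseteq> S" by (auto simp: initial_nodes_def)
  have cov: "topspace K \<subseteq> \<Union> (R ` ?I)"
  proof
    fix x assume "x \<in> topspace K"
    then obtain s where "s \<in> ?I" "s \<in> {s\<in>S. x \<in> R s}"
      using S.initial_exists[OF point_nodes_branch] by blast
    then show "x \<in> \<Union> (R ` ?I)" by blast
  qed
  have "\<forall>V\<in>R ` ?I. openin K V" using IS clopen by auto
  then obtain \<F> where \<F>: "finite \<F>" "\<F> \<subseteq> R ` ?I" "topspace K \<subseteq> \<Union> \<F>"
    using compact cov unfolding compact_space_def compactin_def by meson
  have "R ` ?I \<subseteq> \<F>"
  proof clarify
    fix s assume s: "s \<in> ?I"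
    then have sS: "s \<in> S" using IS by blast
    obtain x where x: "x \<in> R s" using R_nonempty[OF sS] by blast
    then have "x \<in> topspace K" using openin_subset[OF clopen(1)[OF sS]] by blast
    then obtain V where "V \<in> \<F>" "x \<in> V" using \<F>(3) by blast
    then obtain t where t: "t \<in> ?I" "R t \<in> \<F>" "x \<in> R t" using \<F>(2) by blast
    then have "(s, t) \<in> q \<or> (t, s) \<in> q" using point_comparable[OF sS _ x] IS by blast
    then have "s = t" using s t(1) IS unfolding initial_nodes_def by blast
    then show "R s \<in> \<F>" using t by simp
  qed
  then have "finite (R ` ?I)" using \<F>(1) finite_subset by blast
  then show ?thesis using inj_on_subset[OF inj IS] finite_imageD by blast
qed

lemma compact_q: "compact_tree S q"
  using S.compact_space_tree[OF finite_initial] tree_q by (simp add: compact_tree_def)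

definition \<rho> :: "'k \<Rightarrow> 's set" where
  "\<rho> x = {s\<in>S. x \<in> R s}"

lemma \<rho>_continuous: "continuous_map K (tree_topology S q) \<rho>"
  unfolding tree_topology_def continuous_on_generated_topo_iff
proof (intro conjI allI impI)
  have pre: "\<rho> -` tree_nbhd S q s \<inter> topspace K = R s" if s: "s \<in> S" for s
    using openin_subset[OF clopen(1)[OF s]] s point_nodes_branch
    by (auto simp: S.in_U \<rho>_def)
  fix V assume "V \<in> tree_nbhd S q ` S \<union> (\<lambda>t. branches S q - tree_nbhd S q t) ` S"
  then consider s where "s \<in> S" "V = tree_nbhd S q s" | s where "s \<in> S" "V = branches S q - tree_nbhd S q s" by blast
  then show "openin K (\<rho> -` V \<inter> topspace K)"
  proof cases
    case 1
    then show ?thesis using pre clopen by simp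
  next
    case 2
    have "\<rho> -` V \<inter> topspace K = topspace K - R s"
      using pre[OF 2(1)] point_nodes_branch unfolding 2(2) \<rho>_def[symmetric] by blast
    then show ?thesis using clopen(2)[OF 2(1)] by (simp add: closedin_def)
  qed
next
  show "\<rho> ` topspace K \<subseteq> \<Union> (tree_nbhd S q ` S \<union> (\<lambda>t. branches S q - tree_nbhd S q t) ` S)"
  proof clarify
    fix x assume x: "x \<in> topspace K"
    then obtain s where "s \<in> S" "x \<in> R s" using covers by blast
    then have "\<rho> x \<in> tree_nbhd S q s" using point_nodes_branch[OF x] by (simp add: S.in_U \<rho>_def)
    then show "\<rho> x \<in> \<Union> (tree_nbhd S q ` S \<union> (\<lambda>t. branches S q - tree_nbhd S q t) ` S)"
      using \<open>s \<in> S\<close> by blast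
  qed
qed

text \<open>By laminarity, a point of \<open>R s\<close> that avoids all smaller members lies in
  exactly the members containing \<open>R s\<close>. The cores are thus the fibres over the
  nodes.\<close>

lemma \<rho>_eq_under_iff:
  assumes s: "s \<in> S"
  shows "\<rho> x = under q s \<longleftrightarrow> x \<in> core S R s"
proof
  assume eq: "\<rho> x = under q s"
  have "s \<in> under q s" using s by (simp add: under_def q_iff)
  then have "x \<in> R s" using eq by (auto simp: \<rho>_def)
  moreover have "x \<notin> R t" if "t \<in> S" "R t \<subset> R s" for t
  proof
    assume "x \<in> R t"
    then have "t \<in> under q s" using eq that(1) by (auto simp: \<rho>_def)
    then show False using that(2) by (auto simp: under_def q_iff)
  qed
  ultimately show "x \<in> core S R s" by (auto simp: core_def)
next
  assume x: "x \<in> core S R s"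
  have "x \<in> R t \<longleftrightarrow> R s \<subseteq> R t" if t: "t \<in> S" for t
    using x laminar[OF s t] t unfolding core_def by blast
  then show "\<rho> x = under q s" using s by (auto simp: \<rho>_def under_def q_iff)
qed

lemma branch_eq_under:
  assumes "b \<in> branches S q"
  obtains s where "s \<in> S" "b = under q s"
  using S.finite_branch[OF assms finite_branches[OF assms]] S.branchD(2)[OF assms] by blast

lemma \<rho>_surj: "\<rho> ` topspace K = topspace (tree_topology S q)"
  unfolding topspace_tree_topology
proof
  show "\<rho> ` topspace K \<subseteq> branches S q" using point_nodes_branch by (auto simp: \<rho>_def)
  show "branches S q \<subseteq> \<rho> ` topspace K"
  proof
    fix b assume "b \<in> branches S q"
    then obtain s where s: "s \<in> S" "b = under q s" using branch_eq_under by blast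
    obtain x where x: "x \<in> core S R s" using core_nonempty[OF s(1)] by blast
    then have "x \<in> R s" by (simp add: core_def)
    then have "x \<in> topspace K" using openin_subset[OF clopen(1)[OF s(1)]] by blast
    moreover have "\<rho> x = b" using \<rho>_eq_under_iff[OF s(1)] x s(2) by simp
    ultimately show "b \<in> \<rho> ` topspace K" by blast
  qed
qed

lemma same_core:
  assumes "x \<in> topspace K" "\<rho> x = \<rho> y"
  obtains s where "s \<in> S" "x \<in> core S R s" "y \<in> core S R s"
proof -
  have "\<rho> x \<in> branches S q" using point_nodes_branch[OF assms(1)] by (simp add: \<rho>_def)
  then obtain s where s: "s \<in> S" "\<rho> x = under q s" using branch_eq_under by blast
  then show ?thesis using that[OF s(1)] \<rho>_eq_under_iff[OF s(1)] assms(2) by auto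
qed

text \<open>A node that survives a derivation has a surviving node above it of smaller rank. Hence a
  node of rank \<open>a\<close> is gone after stage \<open>a\<close>, and nothing outlives
  \<open>z\<close>.\<close>

lemma index_le: "tree_index S q \<le>o z"
proof -
  have D: "tree_deriv q A \<subseteq> A" for A by (auto simp: tree_deriv_def)
  let ?G = "\<lambda>a. iterated_deriv (tree_deriv q) S (seg z a)"
  have child: "\<exists>t\<in>A. rank t \<in> underS z (rank s)" if s: "s \<in> tree_deriv q A" for s A
  proof -
    obtain t where t: "t \<in> A" "(s, t) \<in> q" "s \<noteq> t" using s by (auto simp: tree_deriv_def)
    then have "R t \<subset> R s" using inj by (auto simp: q_iff inj_on_def)
    then show ?thesis using rank_less[of s t] t by (auto simp: q_iff)
  qed
  \<comment> \<open>A node present at stage \<open>c\<close> has rank at least \<open>c\<close>, by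
    induction on the rank.\<close>
  have ge: "a \<notin> underS z c" if "a \<in> Field z" "s \<in> ?G c" "rank s = a" for a c s
    using that
  proof (induction a arbitrary: c s rule: wf_induct_rule[OF wo_rel.WF[unfolded wo_rel_def, OF wo]])
    case (1 a)
    show ?case
    proof
      assume a: "a \<in> underS z c"
      then have "s \<in> tree_deriv q (?G a)"
        using 1(3) iterated_deriv_seg[OF D wo, of S c] by blast
      then obtain t where t: "t \<in> ?G a" "rank t \<in> underS z (rank s)" using child by blast
      have "rank t \<notin> underS z a"
        using t 1(1)[of "rank t" t a] 1(4) underS_subset_Field[of "rank t" z "rank s"] by (auto simp: underS_def)
      then show False using t(2) 1(4) by simp
    qed
  qed
  have "iterated_deriv (tree_deriv q) S z = {}"
  proof (rule ccontr)
    assume "iterated_deriv (tree_deriv q) S z \<noteq> {}"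
    then obtain s where s: "s \<in> iterated_deriv (tree_deriv q) S z" by blast
    then have "s \<in> S" using iterated_deriv_eq[OF D wo, of S] by blast
    then have rF: "rank s \<in> Field z" by (rule rank_Field)
    then have "s \<in> tree_deriv q (?G (rank s))" using s iterated_deriv_eq[OF D wo, of S] by blast
    then obtain t where t: "t \<in> ?G (rank s)" "rank t \<in> underS z (rank s)" using child by blast
    then show False using ge[OF underS_subset_Field[OF t(2)] t(1) refl] by blast
  qed
  then show ?thesis unfolding tree_index_def by (rule deriv_index_props(3)[OF D wo])
qed

end

section \<open>Layering a ranked tree space\<close>

text \<open>This is what remains of the Szlenk derivation once functionals are forgotten;
  \<open>sm x y\<close> will say that the functionals at \<open>x\<close> and \<open>y\<close> are
  within epsilon/2. Smallness near \<open>b\<close> concerns only points of rank at least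
  \<open>rk b\<close>, because a small slice is available only in the stage to which
  \<open>b\<close> belongs.\<close>

locale ranked_tree_space = tree_space T r for T :: "'t set" and r :: "'t rel" +
  fixes z :: "'c rel" and rk :: "'t set \<Rightarrow> 'c" and sm :: "'t set \<Rightarrow> 't set \<Rightarrow> bool"
  assumes fin: "finite (initial_nodes T r)"
    and wo: "Well_order z"
    and rk_Field: "b \<in> topspace (tree_topology T r) \<Longrightarrow> rk b \<in> Field z"
    and closed_ge: "a \<in> Field z \<Longrightarrow> closedin (tree_topology T r) {b\<in>topspace (tree_topology T r). (a, rk b) \<in> z}"
    and closed_gt: "a \<in> Field z \<Longrightarrow> closedin (tree_topology T r) {b\<in>topspace (tree_topology T r). a \<in> underS z (rk b)}"
    and local_small: "b \<in> topspace (tree_topology T r) \<Longrightarrow> \<exists>N. openin (tree_topology T r) N \<and> b \<in> N \<and>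
      (\<forall>x\<in>N. \<forall>y\<in>N. (rk b, rk x) \<in> z \<longrightarrow> (rk b, rk y) \<in> z \<longrightarrow> sm x y)"
begin

definition top :: "'t set set \<Rightarrow> 't set set" where
  "top C = {b\<in>C. \<forall>c\<in>C. (rk c, rk b) \<in> z}"

lemma
  shows z_refl: "a \<in> Field z \<Longrightarrow> (a, a) \<in> z"
    and z_trans: "trans z"
    and z_antisym: "(a, b) \<in> z \<Longrightarrow> (b, a) \<in> z \<Longrightarrow> a = b"
    and z_total: "a \<in> Field z \<Longrightarrow> b \<in> Field z \<Longrightarrow> a \<noteq> b \<Longrightarrow> (a, b) \<in> z \<or> (b, a) \<in> z"
proof -
  have *: "refl_on (Field z) z" "trans z" "antisym z" "total_on (Field z) z"
    using wo by (auto simp: order_on_defs)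
  show "trans z" by fact
  show "(a, a) \<in> z" if "a \<in> Field z" using *(1) that by (rule refl_onD)
  show "a = b" if "(a, b) \<in> z" "(b, a) \<in> z" using *(3) that by (rule antisymD)
  show "(a, b) \<in> z \<or> (b, a) \<in> z" if "a \<in> Field z" "b \<in> Field z" "a \<noteq> b"
    using *(4) that by (auto simp: total_on_def)
qed

lemma compact_K: "compact_space K"
  by (rule compact_space_tree[OF fin])

text \<open>An upper semicontinuous function attains its maximum on a compact set: the closed sets
  of points of \<open>C\<close> with rank at least \<open>rk b\<close> have the finite intersection
  property.\<close>

lemma top_nonempty:
  assumes C: "closedin K C" "C \<noteq> {}"
  shows "top C \<noteq> {}"
proof -
  have CK: "C \<subseteq> topspace K" using C(1) by (rule closedin_subset)
  define G where "G b = C \<inter> {x\<in>topspace K. (rk b, rk x) \<in> z}" for b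
  have "\<Inter> (G ` C) \<noteq> {}"
  proof (rule compact_space_fip[THEN iffD1, rule_format, OF compact_K], intro conjI ballI allI impI)
    fix V assume "V \<in> G ` C"
    then obtain b where "b \<in> C" "V = G b" by blast
    then show "closedin K V" using CK rk_Field closed_ge C(1) by (auto simp: G_def)
  next
    fix \<F> assume "finite \<F> \<and> \<F> \<subseteq> G ` C"
    then obtain B where B: "B \<subseteq> C" "finite B" "\<F> = G ` B" using finite_subset_image by metis
    show "\<Inter> \<F> \<noteq> {}"
    proof (cases "B = {}")
      case False
      \<comment> \<open>Comparison of points by rank is only a preorder, which suffices for finding
        a greatest element of a finite set.\<close>
      let ?q = "{(b, b'). (rk b, rk b') \<in> z}"
      have "\<exists>m\<in>B. \<forall>a\<in>B. (a, m) \<in> ?q"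
      proof (rule finite_chain_greatest[OF B(2) False])
        have BF: "rk b \<in> Field z" if "b \<in> B" for b using that B(1) CK rk_Field by blast
        show "total_on B ?q" 
          using z_total z_refl BF unfolding total_on_def by (simp add: split_beta) metis
        show "trans ?q" using z_trans by (auto intro!: transI dest: transD)
        show "(a, a) \<in> ?q" if "a \<in> B" for a using z_refl BF that by simp
      qed
      then obtain m where "m \<in> B" "\<forall>a\<in>B. (rk a, rk m) \<in> z" by auto
      then have "m \<in> \<Inter> \<F>" using B CK by (auto simp: G_def)
      then show ?thesis by blast
    qed (use B in simp)
  qed
  then obtain x where x: "x \<in> \<Inter> (G ` C)" by blast
  have "x \<in> top C" using x C(2) by (auto simp: top_def G_def)
  then show ?thesis by blast
qed

lemma closedin_top:
  assumes C: "closedin K C"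
  shows "closedin K (top C)"
proof (cases "C = {}")
  case True
  then show ?thesis by (simp add: top_def)
next
  case False
  then obtain m where m: "m \<in> top C" using top_nonempty[OF C] by blast
  have CK: "C \<subseteq> topspace K" using C by (rule closedin_subset)
  then have "rk m \<in> Field z" using m rk_Field by (auto simp: top_def)
  moreover have "top C = C \<inter> {x\<in>topspace K. (rk m, rk x) \<in> z}"
    using m CK transD[OF z_trans] unfolding top_def by blast
  ultimately show ?thesis using C closed_ge by auto
qed

definition good :: "'t set set \<Rightarrow> bool" where
  "good C \<longleftrightarrow> (\<forall>x\<in>top C. \<forall>y\<in>top C. sm x y)"

text \<open>If \<open>C\<close> contains \<open>b\<close>, its top has rank at least
  \<open>rk b\<close>. Local smallness at \<open>b\<close> therefore makes every small enough
  \<open>C\<close> around \<open>b\<close> good.\<close>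

lemma good_partition:
  assumes V: "openin K V"
  shows "\<exists>P. pairwise disjnt P \<and> \<Union> P = V \<and> (\<forall>C\<in>P. C \<noteq> {} \<and> good C \<and> C \<in> basics)"
proof (rule tree_partition[OF V])
  fix b assume "b \<in> V"
  then have b: "b \<in> topspace K" using openin_subset[OF V] by blast
  obtain N where N: "openin K N" "b \<in> N"
    "\<forall>x\<in>N. \<forall>y\<in>N. (rk b, rk x) \<in> z \<longrightarrow> (rk b, rk y) \<in> z \<longrightarrow> sm x y"
    using local_small[OF b] by blast
  show "\<exists>N. openin K N \<and> b \<in> N \<and> (\<forall>C\<in>basics. b \<in> C \<and> C \<subseteq> N \<longrightarrow> good C)"
  proof (intro exI[of _ N] conjI ballI impI N(1,2))
    fix C assume "b \<in> C \<and> C \<subseteq> N"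
    then show "good C" using N(3) unfolding good_def top_def by blast
  qed
qed

definition part :: "'t set set \<Rightarrow> 't set set set" where
  "part V = (SOME P. pairwise disjnt P \<and> \<Union> P = V \<and> (\<forall>C\<in>P. C \<noteq> {} \<and> good C \<and> C \<in> basics))"

lemma part:
  assumes "openin K V"
  shows "pairwise disjnt (part V)" "\<Union> (part V) = V"
    "C \<in> part V \<Longrightarrow> C \<noteq> {}" "C \<in> part V \<Longrightarrow> good C" "C \<in> part V \<Longrightarrow> C \<in> basics"
  using someI_ex[OF good_partition[OF assms]] unfolding part_def[symmetric] by blast+

section \<open>The levels and the laminar family they form\<close>

primrec lev :: "nat \<Rightarrow> 't set set set" where
  "lev 0 = part (topspace K)"
| "lev (Suc n) = (\<Union>W\<in>lev n. part (W - top W))"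

lemma open_diff_top: "W \<in> basics \<Longrightarrow> openin K (W - top W)"
  using basics_clopen closedin_top by (intro openin_diff) auto

lemma lev_props: "W \<in> lev n \<Longrightarrow> W \<noteq> {} \<and> good W \<and> W \<in> basics"
proof (induction n arbitrary: W)
  case 0
  then show ?case using part(3-5)[OF openin_topspace] by simp
next
  case (Suc n)
  then obtain W' where W': "W' \<in> lev n" "W \<in> part (W' - top W')" by auto
  then have "openin K (W' - top W')" using Suc.IH open_diff_top by blast
  then show ?case using part(3-5) W'(2) by blast
qed

lemma part_diff:
  assumes "W \<in> lev n"
  shows "openin K (W - top W)" "V \<in> part (W - top W) \<Longrightarrow> V \<subseteq> W - top W" "top W \<noteq> {}"
proof -
  show op: "openin K (W - top W)" using lev_props[OF assms] open_diff_top by blast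
  show "V \<subseteq> W - top W" if "V \<in> part (W - top W)" using part(2)[OF op] that by blast
  show "top W \<noteq> {}" using lev_props[OF assms] top_nonempty basics_clopen(2) by blast
qed

text \<open>A common point of two pieces is a common point of their parents, so by induction the
  parents agree and both pieces belong to one partition.\<close>

lemma lev_disjoint: "V \<in> lev n \<Longrightarrow> W \<in> lev n \<Longrightarrow> V \<inter> W \<noteq> {} \<Longrightarrow> V = W"
proof (induction n arbitrary: V W)
  case 0
  then show ?case using part(1)[OF openin_topspace] by (auto simp: pairwise_def disjnt_def)
next
  case (Suc n)
  obtain V' where V': "V' \<in> lev n" "V \<in> part (V' - top V')" using Suc.prems by auto
  obtain W' where W': "W' \<in> lev n" "W \<in> part (W' - top W')" using Suc.prems by auto
  have "V' \<inter> W' \<noteq> {}"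
    using part_diff(2)[OF V'] part_diff(2)[OF W'] Suc.prems(3) by blast
  then have "V' = W'" using Suc.IH V'(1) W'(1) by blast
  then show ?case
    using part(1)[OF part_diff(1)[OF V'(1)]] V'(2) W'(2) Suc.prems(3)
    unfolding pairwise_def disjnt_def by blast
qed

lemma lev_ancestor: "W \<in> lev n \<Longrightarrow> m \<le> n \<Longrightarrow> \<exists>V\<in>lev m. W \<subseteq> V"
proof (induction n arbitrary: W)
  case (Suc n)
  show ?case
  proof (cases "m = Suc n")
    case False
    obtain W' where W': "W' \<in> lev n" "W \<in> part (W' - top W')" using Suc.prems by auto
    then obtain V where "V \<in> lev m" "W' \<subseteq> V" using Suc.IH[OF W'(1)] Suc.prems(2) False by auto
    then show ?thesis using part_diff(2)[OF W'] by blast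
  qed (use Suc.prems in blast)
qed auto

lemma lev_strict_ancestor:
  assumes "W \<in> lev n" "m < n"
  shows "\<exists>V\<in>lev m. W \<subseteq> V - top V"
proof -
  obtain V' where V': "V' \<in> lev (Suc m)" "W \<subseteq> V'" using lev_ancestor[OF assms(1), of "Suc m"] assms(2) by auto
  then obtain V where V: "V \<in> lev m" "V' \<in> part (V - top V)" by auto
  then show ?thesis using V'(2) part_diff(2)[OF V] by blast
qed

definition nodes :: "'t set set set" where
  "nodes = (\<Union>n. lev n)"

lemma nodesI: "W \<in> lev n \<Longrightarrow> W \<in> nodes"
  by (auto simp: nodes_def)

lemma nodesE: assumes "W \<in> nodes" obtains n where "W \<in> lev n"
  using assms by (auto simp: nodes_def)

lemma nodes_props: "W \<in> nodes \<Longrightarrow> W \<noteq> {}" "W \<in> nodes \<Longrightarrow> good W" "W \<in> nodes \<Longrightarrow> W \<in> basics"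
  "W \<in> nodes \<Longrightarrow> top W \<noteq> {}"
  using lev_props part_diff(3) by (auto elim!: nodesE)

lemma nodes_nested_or_disjoint:
  assumes "V \<in> lev m" "W \<in> lev n" "m \<le> n" "V \<inter> W \<noteq> {}"
  shows "W \<subseteq> V"
proof -
  obtain V' where "V' \<in> lev m" "W \<subseteq> V'" using lev_ancestor[OF assms(2,3)] by blast
  then show ?thesis using lev_disjoint[OF assms(1), of V'] assms(4) by blast
qed

lemma nodes_laminar:
  assumes "V \<in> nodes" "W \<in> nodes"
  shows "V \<inter> W = {} \<or> V \<subseteq> W \<or> W \<subseteq> V"
proof -
  obtain m where m: "V \<in> lev m" using assms(1) by (rule nodesE)
  obtain n where n: "W \<in> lev n" using assms(2) by (rule nodesE)
  show ?thesis
    using nodes_nested_or_disjoint[OF m n] nodes_nested_or_disjoint[OF n m] by (cases "m \<le> n") auto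
qed

text \<open>Each level has at most one member containing \<open>W\<close>, by disjointness, and a
  containing member from a level deeper than that of \<open>W\<close> is \<open>W\<close>
  itself.\<close>

lemma nodes_finite_above:
  assumes W: "W \<in> nodes"
  shows "finite {V\<in>nodes. W \<subseteq> V}"
proof -
  obtain n where n: "W \<in> lev n" using W by (rule nodesE)
  have ne: "W \<noteq> {}" using nodes_props W by blast
  have "finite {V\<in>lev m. W \<subseteq> V}" for m
  proof (cases "\<exists>V\<in>lev m. W \<subseteq> V")
    case True
    then obtain V where V: "V \<in> lev m" "W \<subseteq> V" by blast
    have "{V\<in>lev m. W \<subseteq> V} \<subseteq> {V}"
    proof
      fix V' assume "V' \<in> {V\<in>lev m. W \<subseteq> V}"
      then show "V' \<in> {V}" using lev_disjoint[of V' m V] V ne by blast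
    qed
    then show ?thesis using finite_subset by blast
  next
    case False
    then have "{V\<in>lev m. W \<subseteq> V} = {}" by blast
    then show ?thesis by (simp only: finite.emptyI)
  qed
  moreover have "{V\<in>nodes. W \<subseteq> V} \<subseteq> (\<Union>m\<in>{..n}. {V\<in>lev m. W \<subseteq> V})"
  proof
    fix V assume V: "V \<in> {V\<in>nodes. W \<subseteq> V}"
    then obtain m where m: "V \<in> lev m" by (auto elim: nodesE)
    show "V \<in> (\<Union>m\<in>{..n}. {V\<in>lev m. W \<subseteq> V})"
    proof (cases "m \<le> n")
      case True
      then show ?thesis using m V by blast
    next
      case False
      then have "V \<subseteq> W" using nodes_nested_or_disjoint[OF n m] V ne by auto
      then have "V = W" using V by blast
      then show ?thesis using n by blast
    qed
  qed
  ultimately show ?thesis by (meson finite_UN_I finite_atMost finite_subset)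
qed

text \<open>A smaller member comes from a deeper level, and its ancestor at the level of
  \<open>W\<close> can only be \<open>W\<close>, whose top was discarded before the next
  partition.\<close>

lemma nodes_strict:
  assumes W: "W \<in> nodes" and V: "V \<in> nodes" "V \<subset> W"
  shows "V \<subseteq> W - top W"
proof -
  obtain m where m: "W \<in> lev m" using W by (rule nodesE)
  obtain n where n: "V \<in> lev n" using V(1) by (rule nodesE)
  have ne: "V \<noteq> {}" using nodes_props V by blast
  have "m < n"
  proof (rule ccontr)
    assume "\<not> m < n"
    then have "W \<subseteq> V" using nodes_nested_or_disjoint[OF n m] V ne by auto
    then show False using V by blast
  qed
  then obtain W' where W': "W' \<in> lev m" "V \<subseteq> W' - top W'" using lev_strict_ancestor[OF n] by blast
  then have "W' = W" using lev_disjoint[OF W'(1) m] V ne by blast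
  then show ?thesis using W' by blast
qed

text \<open>The pieces of the next level inside \<open>W\<close> cover everything but the top, and
  no smaller member meets the top.\<close>

lemma nodes_core:
  assumes W: "W \<in> nodes"
  shows "W - \<Union> {V\<in>nodes. V \<subset> W} = top W"
proof
  have "top W \<subseteq> W" by (auto simp: top_def)
  then show "top W \<subseteq> W - \<Union> {V\<in>nodes. V \<subset> W}" using nodes_strict[OF W] by blast
  show "W - \<Union> {V\<in>nodes. V \<subset> W} \<subseteq> top W"
  proof (rule subsetI, rule ccontr)
    fix x assume x: "x \<in> W - \<Union> {V\<in>nodes. V \<subset> W}" "x \<notin> top W"
    obtain n where n: "W \<in> lev n" using W by (rule nodesE)
    obtain V where V: "V \<in> part (W - top W)" "x \<in> V" using x part(2)[OF part_diff(1)[OF n]] by blast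
    have "V \<in> lev (Suc n)" using V n by auto
    then have "V \<in> nodes" by (rule nodesI)
    moreover have "V \<subset> W"
      using part_diff(2)[OF n V(1)] part_diff(3)[OF n] \<open>top W \<subseteq> W\<close> by blast
    ultimately show False using x V(2) by blast
  qed
qed

text \<open>All points of the top share one rank, so the choice is immaterial.\<close>

definition node_rank :: "'t set set \<Rightarrow> 'c" where
  "node_rank W = rk (SOME m. m \<in> top W)"

lemma node_rank:
  assumes "W \<in> nodes"
  obtains m where "m \<in> top W" "node_rank W = rk m"
  using someI_ex[of "\<lambda>m. m \<in> top W"] nodes_props(4)[OF assms] unfolding node_rank_def by blast

lemma nodes_subset: "W \<in> nodes \<Longrightarrow> W \<subseteq> topspace K"
  using nodes_props(3) basics_clopen(1) openin_subset by blast

text \<open>A top point of \<open>V\<close> lies in \<open>W\<close> off its top, so its rank falls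
  short of the maximum over \<open>W\<close>.\<close>

lemma node_rank_less:
  assumes W: "W \<in> nodes" and V: "V \<in> nodes" "V \<subset> W"
  shows "node_rank V \<in> underS z (node_rank W)"
proof -
  obtain m where m: "m \<in> top W" "node_rank W = rk m" using node_rank[OF W] by blast
  obtain x where x: "x \<in> top V" "node_rank V = rk x" using node_rank[OF V(1)] by blast
  have xW: "x \<in> W" "x \<notin> top W" using x(1) nodes_strict[OF W V] by (auto simp: top_def)
  have "rk x \<noteq> rk m" using xW m(1) by (auto simp: top_def)
  moreover have "(rk x, rk m) \<in> z" using m(1) xW(1) by (auto simp: top_def)
  ultimately show ?thesis using m x by (simp add: underS_def)
qed

text \<open>For infinite \<open>T\<close> the nodes are counted among the basic sets. For finite
  \<open>T\<close> all branches are finite, so each top contains the branch of some element of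
  \<open>T\<close>; tops of distinct nodes are disjoint, which makes this assignment
  injective.\<close>

lemma card_nodes: "card_of nodes \<le>o card_of T"
proof (cases "finite T")
  case False
  have "card_of nodes \<le>o card_of basics" using nodes_props(3) by (intro card_of_mono1) blast
  then show ?thesis using card_basics[OF False] ordLeq_transitive by blast
next
  case True
  have "\<exists>t\<in>T. under r t \<in> top W" if W: "W \<in> nodes" for W
  proof -
    obtain b where b: "b \<in> top W" using nodes_props(4)[OF W] by blast
    then have "b \<in> branches T r" using nodes_subset[OF W] by (auto simp: top_def topspace_tree_topology)
    moreover then have "finite b" using branchD(2) True finite_subset by blast
    ultimately obtain t where "t \<in> b" "b = under r t" using finite_branch by blast
    then show ?thesis using b branchD(2) \<open>b \<in> branches T r\<close> by blast
  qed
  then obtain f where f: "\<And>W. W \<in> nodes \<Longrightarrow> f W \<in> T \<and> under r (f W) \<in> top W" by metis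
  have "inj_on f nodes"
  proof (rule inj_onI, rule ccontr)
    fix V W assume VW: "V \<in> nodes" "W \<in> nodes" "f V = f W" "V \<noteq> W"
    then have x: "under r (f V) \<in> top V" "under r (f V) \<in> top W" using f[of V] f[of W] by auto
    have "V \<inter> W \<noteq> {}" using x by (auto simp: top_def)
    then have "V \<subset> W \<or> W \<subset> V" using nodes_laminar[OF VW(1,2)] VW(4) by blast
    then show False using nodes_strict[OF VW(1,2)] nodes_strict[OF VW(2,1)] x by (auto simp: top_def)
  qed
  then show ?thesis using f card_of_ordLeq[of nodes T] by blast
qed

text \<open>The cardinality bound allows the clopen sets to be labelled by elements of
  \<open>T\<close>, with \<open>R\<close> decoding a label. The cores are the tops, and these are
  small because all nodes are good.\<close>

lemma layering:
  "\<exists>(S :: 't set) R rank. laminar_family K S R z rank \<and> (\<forall>s\<in>S. \<forall>x\<in>core S R s. \<forall>y\<in>core S R s. sm x y)"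
proof -
  obtain f where f: "inj_on f nodes" "f ` nodes \<subseteq> T" using card_nodes card_of_ordLeq[of nodes T] by blast
  define S where "S = f ` nodes"
  define R where "R = inv_into nodes f"
  have inj: "inj_on R S" unfolding R_def S_def by (simp add: inj_on_inv_into)
  have img: "R ` S = nodes" unfolding R_def S_def using f(1) by (simp add: inv_into_image_cancel)
  then have RS: "R s \<in> nodes" if "s \<in> S" for s using that by blast
  have core: "core S R s = top (R s)" if s: "s \<in> S" for s
  proof -
    have "{R t | t. t \<in> S \<and> R t \<subset> R s} = {V\<in>nodes. V \<subset> R s}"
      unfolding img[symmetric] by auto
    then show ?thesis using nodes_core[OF RS[OF s]] by (simp add: core_def)
  qed
  have "laminar_family K S R z (node_rank \<circ> R)"
  proof
    show "\<Union> (R ` S) = topspace K"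
    proof
      show "\<Union> (R ` S) \<subseteq> topspace K" unfolding img using nodes_subset by auto
      have "lev 0 \<subseteq> nodes" using nodesI by blast
      then have "\<Union> (part (topspace K)) \<subseteq> \<Union> nodes" by (simp add: Union_mono)
      then show "topspace K \<subseteq> \<Union> (R ` S)" unfolding img part(2)[OF openin_topspace] .
    qed
    fix s assume s: "s \<in> S"
    show "openin K (R s)" "closedin K (R s)" using basics_clopen nodes_props(3)[OF RS[OF s]] by auto
    show "core S R s \<noteq> {}" using core[OF s] nodes_props(4)[OF RS[OF s]] by simp
    have "R ` {t \<in> S. R s \<subseteq> R t} \<subseteq> {V\<in>nodes. R s \<subseteq> V}" using RS by auto
    then have "finite (R ` {t \<in> S. R s \<subseteq> R t})"
      using nodes_finite_above[OF RS[OF s]] finite_subset by blast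
    then show "finite {t \<in> S. R s \<subseteq> R t}"
      by (rule finite_imageD) (rule inj_on_subset[OF inj], blast)
    show "(node_rank \<circ> R) s \<in> Field z"
    proof -
      obtain m where "m \<in> top (R s)" "node_rank (R s) = rk m" using node_rank[OF RS[OF s]] by blast
      then show ?thesis using rk_Field nodes_subset[OF RS[OF s]] by (auto simp: top_def)
    qed
    fix t assume t: "t \<in> S"
    show "R s \<inter> R t = {} \<or> R s \<subseteq> R t \<or> R t \<subseteq> R s" by (rule nodes_laminar[OF RS[OF s] RS[OF t]])
    show "(node_rank \<circ> R) t \<in> underS z ((node_rank \<circ> R) s)" if "R t \<subset> R s"
      using node_rank_less[OF RS[OF s] RS[OF t] that] by simp
  qed (rule compact_K inj wo)+
  moreover have "\<forall>s\<in>S. \<forall>x\<in>core S R s. \<forall>y\<in>core S R s. sm x y"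
    using core nodes_props(2)[OF RS] unfolding good_def by auto
  ultimately show ?thesis by blast
qed

end

section \<open>The approximation theorem\<close>

lemma closedin_strong_operator_cball:
  "closedin strong_operator_topology (cball (0 :: 'a::real_normed_vector \<Rightarrow>\<^sub>L real) 1)"
proof -
  have "cball (0 :: 'a \<Rightarrow>\<^sub>L real) 1 = (\<Inter>x\<in>{x. norm x \<le> 1}. {f. blinfun_apply f x \<le> 1})"
  proof (intro equalityI subsetI)
    fix f :: "'a \<Rightarrow>\<^sub>L real" assume f: "f \<in> cball 0 1"
    have "blinfun_apply f x \<le> 1" if x: "norm x \<le> 1" for x
    proof -
      have "blinfun_apply f x \<le> norm f * norm x" using norm_blinfun[of f x] by simp
      also have "\<dots> \<le> 1" using f x by (simp add: mult_le_one)
      finally show ?thesis .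
    qed
    then show "f \<in> (\<Inter>x\<in>{x. norm x \<le> 1}. {f. blinfun_apply f x \<le> 1})" by simp
  next
    fix f :: "'a \<Rightarrow>\<^sub>L real" assume f: "f \<in> (\<Inter>x\<in>{x. norm x \<le> 1}. {f. blinfun_apply f x \<le> 1})"
    have "norm f \<le> 1"
    proof (rule ccontr)
      assume "\<not> norm f \<le> 1"
      then have "1 < norm f" by simp
      then obtain x where "norm x \<le> 1" "1 < blinfun_apply f x"
        by (rule blinfun_norm_witness) auto
      then show False using f by force
    qed
    then show "f \<in> cball 0 1" by simp
  qed
  moreover have "{x :: 'a. norm x \<le> 1} \<noteq> {}" by (auto intro: exI[of _ 0])
  ultimately show ?thesis
    using openin_strong_operator_halfspaces(4) by (auto intro!: closedin_INT)
qed

text \<open>What is removed is the part of \<open>F\<close> covered by the weak-star open sets that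
  cut out slices of diameter below \<open>e\<close>.\<close>

lemma closedin_szlenk_deriv:
  assumes "closedin strong_operator_topology F"
  shows "closedin strong_operator_topology (szlenk_deriv e F)"
proof -
  let ?U = "\<Union> {U. openin strong_operator_topology U \<and> \<not> e \<le> diameter (U \<inter> F)}"
  have "szlenk_deriv e F = F - ?U" by (auto simp: szlenk_deriv_def)
  moreover have "openin strong_operator_topology ?U" by (rule openin_Union) blast
  ultimately show ?thesis using assms by (simp add: closedin_diff)
qed

lemma closedin_szlenk_iterate:
  assumes wo: "Well_order z" and F: "closedin strong_operator_topology F" and a: "a \<in> Field z"
  shows "closedin strong_operator_topology (iterated_deriv (szlenk_deriv e) F (seg z a))"
  using a
proof (induction a rule: wf_induct_rule[OF wo_rel.WF[unfolded wo_rel_def, OF wo]])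
  case (1 a)
  show ?case
    unfolding iterated_deriv_seg[OF szlenk_deriv_subset wo, where a=a]
  proof (cases "underS z a = {}")
    case False
    have "closedin strong_operator_topology (szlenk_deriv e (iterated_deriv (szlenk_deriv e) F (seg z b)))"
      if "b \<in> underS z a" for b
      using 1(1)[of b] that underS_subset_Field[OF that] by (intro closedin_szlenk_deriv) (auto simp: underS_def)
    then show "closedin strong_operator_topology
      (F \<inter> (\<Inter>b\<in>underS z a. szlenk_deriv e (iterated_deriv (szlenk_deriv e) F (seg z b))))"
      using False F by (intro closedin_Int closedin_INT) auto
  qed (simp add: F)
qed

text \<open>The rank of \<open>x\<close> is the first stage whose derivative loses \<open>x\<close>.
  All earlier derivatives contain \<open>x\<close>, so the uniform formula places \<open>x\<close>
  in that stage, whether it is zero, a successor or a limit.\<close>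

lemma deriv_rank:
  assumes D: "\<And>A. D A \<subseteq> A" and wo: "Well_order z" and e: "iterated_deriv D F z = {}" and x: "x \<in> F"
  shows "\<exists>a\<in>Field z. x \<in> iterated_deriv D F (seg z a) \<and> x \<notin> D (iterated_deriv D F (seg z a))"
proof -
  let ?B = "{a\<in>Field z. x \<notin> D (iterated_deriv D F (seg z a))}"
  obtain a0 where a0: "a0 \<in> ?B" using e x iterated_deriv_eq[OF D wo, of F] by blast
  obtain a where a: "a \<in> ?B" "\<And>b. (b, a) \<in> z - Id \<Longrightarrow> b \<notin> ?B"
    by (rule wfE_min[OF wo_rel.WF[unfolded wo_rel_def, OF wo] a0]) (rule that)
  have "x \<in> D (iterated_deriv D F (seg z b))" if b: "b \<in> underS z a" for b
  proof -
    have "(b, a) \<in> z - Id" using b by (auto simp: underS_def)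
    then show ?thesis using a(2)[of b] underS_subset_Field[OF b] by blast
  qed
  then have "x \<in> iterated_deriv D F (seg z a)"
    unfolding iterated_deriv_seg[OF D wo, where a=a] using x by blast
  then show ?thesis using a(1) by blast
qed

theorem theorem5p1:
  fixes T :: "'t set" and r :: "'t rel"
    and i :: "'a::banach \<Rightarrow> 't set \<Rightarrow> real"
    and \<epsilon> :: real
  assumes "asplund TYPE('a)"
    and "tree T r" and "finite (initial_nodes T r)"
    and "isometric_embedding_C i (tree_topology T r)"
    and "\<epsilon> > 0"
  shows "\<exists>(S :: 't set) (q :: 't rel) (Y :: ('t set \<Rightarrow> real) set).
    well_founded_tree S q \<and> compact_tree S q \<and>
    tree_index S q <o szlenk_index TYPE('a) (\<epsilon> / 2) +o natLeq \<and>
    subspace_C Y (tree_topology T r) \<and>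
    isometrically_isomorphic_C Y (tree_topology T r) (tree_topology S q) \<and>
    (\<forall>x. \<exists>y\<in>Y. mdist (C_space (tree_topology T r)) (i x) y \<le> \<epsilon> * norm x)"
proof -
  interpret T: tree_space T r by standard fact
  let ?K = "tree_topology T r"
  let ?S = "strong_operator_topology :: ('a \<Rightarrow>\<^sub>L real) topology"
  have compK: "compact_space ?K" by (rule T.compact_space_tree[OF assms(3)])
  have iM: "i x \<in> mspace (C_space ?K)" for x
    using assms(4) by (auto simp: isometric_embedding_C_def)
  have i_add: "i (x + y) b = i x b + i y b" and i_scale: "i (c *\<^sub>R x) b = c * i x b"
    if "b \<in> topspace ?K" for x y c b
    using assms(4) that by (simp_all add: isometric_embedding_C_def C_add_def C_scale_def)
  have i_zero: "i 0 b = 0" if "b \<in> topspace ?K" for b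
    using i_scale[OF that, of 0 0] by simp
  have i_bound: "\<bar>i x b\<bar> \<le> norm x" if b: "b \<in> topspace ?K" for x b
  proof -
    have "\<bar>i x b - i 0 b\<bar> \<le> mdist (C_space ?K) (i x) (i 0)"
      by (rule mdist_C_space_upper[OF iM iM b])
    also have "\<dots> = norm x" using assms(4) by (simp add: isometric_embedding_C_def)
    finally show ?thesis using i_zero[OF b] by simp
  qed
  have i_cont: "continuous_map ?K euclidean (i x)" for x
    using iM[of x] unfolding mspace_C_space[OF compK] by blast
  \<comment> \<open>Evaluation at \<open>b\<close>. \<open>Blinfun\<close> is meaningful only where
    evaluation is linear and bounded, that is, for \<open>b\<close> in the space.\<close>
  define \<phi> where "\<phi> b = Blinfun (\<lambda>x. i x b)" for b
  have \<phi>: "blinfun_apply (\<phi> b) x = i x b" if b: "b \<in> topspace ?K" for b x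
  proof -
    have "bounded_linear (\<lambda>x. i x b)"
      by (rule bounded_linear_intro[where K=1]) (simp_all add: i_add i_scale i_bound b)
    then show ?thesis by (simp add: \<phi>_def bounded_linear_Blinfun_apply)
  qed
  have \<phi>_ball: "\<phi> b \<in> cball 0 1" if b: "b \<in> topspace ?K" for b
    using \<phi>[OF b] i_bound[OF b] by (auto intro: norm_blinfun_bound)
  have \<phi>_cont: "continuous_map ?K ?S \<phi>"
    unfolding continuous_on_strong_operator_topo_iff_coordinatewise
    by (intro allI continuous_map_eq[OF i_cont]) (simp add: \<phi>)
  define e where "e = \<epsilon> / 2"
  have e: "e > 0" using assms(5) by (simp add: e_def)
  define z where "z = szlenk_index TYPE('a) e"
  have wo: "Well_order z" and zero: "iterated_deriv (szlenk_deriv e) (cball (0 :: 'a \<Rightarrow>\<^sub>L real) 1) z = {}"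
    unfolding z_def by (rule szlenk_index_props[OF assms(1) e])+
  define H where "H a = iterated_deriv (szlenk_deriv e) (cball (0 :: 'a \<Rightarrow>\<^sub>L real) 1) (seg z a)" for a
  have H: "H a = cball 0 1 \<inter> (\<Inter>b\<in>underS z a. szlenk_deriv e (H b))" for a
    unfolding H_def by (rule iterated_deriv_seg[OF szlenk_deriv_subset wo])
  have H_closed: "closedin ?S (H a)" if "a \<in> Field z" for a
    unfolding H_def by (rule closedin_szlenk_iterate[OF wo closedin_strong_operator_cball that])
  have "\<exists>a\<in>Field z. \<phi> b \<in> H a \<and> \<phi> b \<notin> szlenk_deriv e (H a)" if "b \<in> topspace ?K" for b
    unfolding H_def by (rule deriv_rank[OF szlenk_deriv_subset wo zero \<phi>_ball[OF that]])
  then obtain rk where rk: "\<And>b. b \<in> topspace ?K \<Longrightarrow>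
      rk b \<in> Field z \<and> \<phi> b \<in> H (rk b) \<and> \<phi> b \<notin> szlenk_deriv e (H (rk b))"
    by metis
  have z_refl: "(a, a) \<in> z" if "a \<in> Field z" for a
    using wo that by (auto simp: order_on_defs refl_on_def)
  \<comment> \<open>The stages decrease, so comparing a rank with \<open>a\<close> amounts to
    membership in stage \<open>a\<close> or in its derivative. Both are weak-star closed, and their
    preimages are closed.\<close>
  have gt_iff: "a \<in> underS z (rk b) \<longleftrightarrow> \<phi> b \<in> szlenk_deriv e (H a)"
    and ge_iff: "(a, rk b) \<in> z \<longleftrightarrow> \<phi> b \<in> H a" if a: "a \<in> Field z" and b: "b \<in> topspace ?K" for a b
  proof -
    have 1: "\<phi> b \<in> szlenk_deriv e (H a)" if "a \<in> underS z (rk b)"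
      using rk[OF b] H[of "rk b"] that by blast
    have 2: "\<phi> b \<notin> H a" if "rk b \<in> underS z a"
      using rk[OF b] H[of a] that by blast
    have sub: "szlenk_deriv e (H a) \<subseteq> H a" by (rule szlenk_deriv_subset)
    consider "a \<in> underS z (rk b)" | "a = rk b" | "rk b \<in> underS z a"
      using Well_order_cases[OF wo a, of "rk b"] rk[OF b] by blast
    note cases = this
    show "a \<in> underS z (rk b) \<longleftrightarrow> \<phi> b \<in> szlenk_deriv e (H a)"
    proof (cases rule: cases)
      case 2
      then show ?thesis using rk[OF b] by (auto simp: underS_def)
    qed (use 1 2 sub not_underS_sym[OF wo] in blast)+
    show "(a, rk b) \<in> z \<longleftrightarrow> \<phi> b \<in> H a"
    proof (cases rule: cases)
      case 1
      then have "(a, rk b) \<in> z" by (simp add: underS_def)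
      then show ?thesis using \<open>a \<in> underS z (rk b) \<Longrightarrow> \<phi> b \<in> szlenk_deriv e (H a)\<close> 1 sub by blast
    next
      case 2
      then show ?thesis using rk[OF b] z_refl by auto
    next
      case 3
      then have "(a, rk b) \<notin> z" using not_underS_sym[OF wo, of "rk b" a] by (auto simp: underS_def)
      then show ?thesis using 2 3 by blast
    qed
  qed
  define sm where "sm x y \<longleftrightarrow> dist (\<phi> x) (\<phi> y) \<le> e" for x y
  interpret R: ranked_tree_space T r z rk sm
  proof
    show "finite (initial_nodes T r)" by fact
    show "Well_order z" by fact
    show "rk b \<in> Field z" if "b \<in> topspace ?K" for b using rk[OF that] by blast
    fix a assume a: "a \<in> Field z"
    have "{b \<in> topspace ?K. (a, rk b) \<in> z} = {b \<in> topspace ?K. \<phi> b \<in> H a}" using ge_iff[OF a] by blast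
    then show "closedin ?K {b \<in> topspace ?K. (a, rk b) \<in> z}"
      using closedin_continuous_map_preimage[OF \<phi>_cont H_closed[OF a]] by simp
    have "{b \<in> topspace ?K. a \<in> underS z (rk b)} = {b \<in> topspace ?K. \<phi> b \<in> szlenk_deriv e (H a)}"
      using gt_iff[OF a] by blast
    then show "closedin ?K {b \<in> topspace ?K. a \<in> underS z (rk b)}"
      using closedin_continuous_map_preimage[OF \<phi>_cont closedin_szlenk_deriv[OF H_closed[OF a]]] by simp
  next
    fix b assume b: "b \<in> topspace ?K"
    \<comment> \<open>\<open>\<phi> b\<close> is lost at stage \<open>rk b\<close>, so some slice of
      that stage around it has diameter below \<open>e\<close>. Nearby points of rank at least
      \<open>rk b\<close> are mapped into this slice.\<close>
    then obtain U where U: "openin ?S U" "\<phi> b \<in> U" "\<not> e \<le> diameter (U \<inter> H (rk b))"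
      using rk[OF b] unfolding szlenk_deriv_def by blast
    let ?N = "{x \<in> topspace ?K. \<phi> x \<in> U}"
    \<comment> \<open>For an unbounded set the real-valued \<open>diameter\<close> would not control
      distances.\<close>
    have "bounded (U \<inter> H (rk b))"
      using H[of "rk b"] by (intro bounded_subset[OF bounded_cball[of 0 1]]) blast
    then have "sm x y" if "x \<in> ?N" "y \<in> ?N" "(rk b, rk x) \<in> z" "(rk b, rk y) \<in> z" for x y
      using diameter_bounded_bound[of "U \<inter> H (rk b)" "\<phi> x" "\<phi> y"] that U(3) ge_iff[of "rk b"] rk[OF b]
      by (auto simp: sm_def)
    moreover have "openin ?K ?N" by (rule openin_continuous_map_preimage[OF \<phi>_cont U(1)])
    ultimately show "\<exists>N. openin ?K N \<and> b \<in> N \<and> (\<forall>x\<in>N. \<forall>y\<in>N. (rk b, rk x) \<in> z \<longrightarrow> (rk b, rk y) \<in> z \<longrightarrow> sm x y)"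
      using b U(2) by (intro exI[of _ ?N]) auto
  qed
  obtain S :: "'t set" and R rank where fam: "laminar_family ?K S R z rank"
    and small: "\<forall>s\<in>S. \<forall>x\<in>core S R s. \<forall>y\<in>core S R s. sm x y"
    using R.layering by blast
  interpret L: laminar_family ?K S R z rank by (rule fam)
  let ?L = "tree_topology S L.q"
  have compL: "compact_space ?L" using L.compact_q by (simp add: compact_tree_def)
  define Y where "Y = (\<lambda>f::'t set \<Rightarrow> real. \<lambda>x\<in>topspace ?K. f (L.\<rho> x)) ` mspace (C_space ?L)"
  have Y: "subspace_C Y ?K" "isometrically_isomorphic_C Y ?K ?L"
    unfolding Y_def by (rule C_space_quotient[OF compK compL L.\<rho>_continuous L.\<rho>_surj])+
  have "\<exists>y\<in>Y. mdist (C_space ?K) (i x) y \<le> \<epsilon> * norm x" for x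
  \<comment> \<open>The strict inequality between \<open>e * norm x\<close> and
    \<open>\<epsilon> * norm x\<close> used in the other case fails at zero.\<close>
  proof (cases "x = 0")
    case True
    have "mdist (C_space ?K) (i 0) (C_zero ?K) \<le> 0"
      by (rule mdist_cfunspace_le) (simp_all add: i_zero C_zero_def)
    then show ?thesis using True Y(1) by (auto simp: subspace_C_def)
  next
    case False
    have osc: "\<bar>i x b - i x c\<bar> < \<epsilon> * norm x"
      if bc: "b \<in> topspace ?K" "c \<in> topspace ?K" "L.\<rho> b = L.\<rho> c" for b c
    proof -
      obtain s where "s \<in> S" "b \<in> core S R s" "c \<in> core S R s" using L.same_core[OF bc(1,3)] by blast
      then have "norm (\<phi> b - \<phi> c) \<le> e" using small by (auto simp: sm_def dist_norm)
      then have "norm (\<phi> b - \<phi> c) * norm x \<le> e * norm x" by (simp add: mult_right_mono)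
      moreover have "\<bar>i x b - i x c\<bar> \<le> norm (\<phi> b - \<phi> c) * norm x"
        using norm_blinfun[of "\<phi> b - \<phi> c" x] by (simp add: blinfun.diff_left \<phi> bc)
      moreover have "e * norm x < \<epsilon> * norm x" using False assms(5) by (simp add: e_def)
      ultimately show ?thesis by linarith
    qed
    obtain f where f: "f \<in> mspace (C_space ?L)" "\<forall>b\<in>topspace ?K. \<bar>i x b - f (L.\<rho> b)\<bar> \<le> \<epsilon> * norm x"
      using L.S.locally_constant_approx[OF compK L.\<rho>_continuous L.\<rho>_surj L.finite_initial i_cont osc] by blast
    have "mdist (C_space ?K) (i x) (\<lambda>b\<in>topspace ?K. f (L.\<rho> b)) \<le> \<epsilon> * norm x"
      by (rule mdist_cfunspace_le) (use f(2) assms(5) in \<open>simp_all add: dist_real_def\<close>)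
    then show ?thesis using f(1) unfolding Y_def by blast
  qed
  moreover have "tree_index S L.q <o szlenk_index TYPE('a) (\<epsilon> / 2) +o natLeq"
  proof -
    \<comment> \<open>The index is at most \<open>z\<close>, and passing to the sum with a non-empty
      ordinal makes the inequality strict.\<close>
    have "Field natLeq \<noteq> {}" by (simp add: Field_natLeq)
    then have "z <o ord_sum z natLeq" by (rule ordLess_ord_sum[OF wo natLeq_Well_order])
    then show ?thesis using ordLeq_ordLess_trans[OF L.index_le] by (simp add: z_def e_def)
  qed
  ultimately show ?thesis using L.well_founded_q L.compact_q Y by blast
qed

end
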